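(* Let $(R,\mathfrak{m})$ be a one-dimensional Cohen-Macaulay local ring for which $\mathrm{index}(R)$ is finite. Let $s=\mathrm{index}(R)$ and let $x\in\mathfrak{m}^{t}\setminus\mathfrak{m}^{t+1}$ be a nonzerodivisor of $R$, where $t\ge 1$. If the map induced by multiplication by $x$, $$\overline{x}:\mathfrak{m}^{i-1}/\mathfrak{m}^{i}\longrightarrow \mathfrak{m}^{i+t-1}/\mathfrak{m}^{i+t},$$ is injective for $1\le i\le s$, then $$\mathrm{g}\ell\ell(R)\le \mathrm{index}(R)+t-1.$$ Moreover, if $\mathfrak{m}^{s+t-1}$ is not a principal ideal, then $\mathfrak{m}^{s+t-1}\subseteq (x)$.
   Context: Local rings are commutative and Noetherian; $\mathfrak{m}^0=R$. For a Cohen-Macaulay local ring $(R,\mathfrak{m})$ and a finitely generated $R$-module $M$, Auslander's $\delta$-invariant $\delta_R(M)$ is the smallest non-negative integer $n$ such that there is a surjective $R$-linear map $X\oplus R^n\to M$, where $X$ is a maximal Cohen-Macaulay $R$-module with no free direct summand ($X=0$ is allowed). The index of $R$ is $\mathrm{index}(R)=\inf\{n\ge 1 : \delta_R(R/\mathfrak{m}^n)=1\}$. The generalized Loewy length $\mathrm{g}\ell\ell(R)$ is the smallest positive integer $n$ for which $\mathfrak{m}^n$ is contained in the ideal generated by some system of parameters of $R$. *)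

theory Defs
  imports
    "HOL-Algebra.Ideal_Product"
    "HOL-Algebra.QuotRing"
    "HOL-Algebra.Ring_Divisibility"
    "HOL-Library.Extended_Nat"
    "Jordan_Normal_Form.Missing_VectorSpace"
begin

section \<open>Local rings\<close>

locale noetherian_local_ring = cring R + noetherian_ring R
  for R (structure) +
  fixes \<mm> :: "'a set"
  assumes unique_maximal: "{I. maximalideal I R} = {\<mm>}"

primrec ideal_power :: "('a, 'b) ring_scheme \<Rightarrow> 'a set \<Rightarrow> nat \<Rightarrow> 'a set" where
  "ideal_power R I 0 = carrier R"
| "ideal_power R I (Suc n) = I \<cdot>\<^bsub>R\<^esub> ideal_power R I n"

definition ideal_radical :: "('a, 'b) ring_scheme \<Rightarrow> 'a set \<Rightarrow> 'a set" where
  "ideal_radical R I = {a \<in> carrier R. \<exists>k::nat. a [^]\<^bsub>R\<^esub> k \<in> I}"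

definition krull_dim :: "('a, 'b) ring_scheme \<Rightarrow> enat" where
  "krull_dim R = Sup {enat n |n. \<exists>P. (\<forall>i\<le>n. primeideal (P i) R) \<and> (\<forall>i<n. P i \<subset> P (Suc i))}"

definition nonzerodivisor :: "('a, 'b) ring_scheme \<Rightarrow> 'a \<Rightarrow> bool" where
  "nonzerodivisor R x \<longleftrightarrow> x \<in> carrier R \<and> (\<forall>y\<in>carrier R. x \<otimes>\<^bsub>R\<^esub> y = \<zero>\<^bsub>R\<^esub> \<longrightarrow> y = \<zero>\<^bsub>R\<^esub>)"


section \<open>Modules\<close>

text \<open>A module is a record extending that of rings; its fields \<open>mult\<close> and \<open>one\<close> play no role.\<close>

definition ring_as_module :: "('a, 'b) ring_scheme \<Rightarrow> ('a, 'a) module" where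
  "ring_as_module R =
     \<lparr>carrier = carrier R, monoid.mult = monoid.mult R, one = \<one>\<^bsub>R\<^esub>, zero = \<zero>\<^bsub>R\<^esub>, add = add R, smult = monoid.mult R\<rparr>"

definition quotient_module :: "('a, 'b, 'c) module_scheme \<Rightarrow> 'b set \<Rightarrow> ('a, 'b set) module" where
  "quotient_module M N =
     \<lparr>carrier = a_rcosets\<^bsub>M\<^esub> N, monoid.mult = (\<lambda>A B. N), one = N, zero = N, add = set_add M,
      smult = (\<lambda>r A. \<Union>v\<in>A. N +>\<^bsub>M\<^esub> (r \<odot>\<^bsub>M\<^esub> v))\<rparr>"

definition free_module :: "('a, 'b) ring_scheme \<Rightarrow> nat \<Rightarrow> ('a, nat \<Rightarrow> 'a) module" where
  "free_module R n = ring.func_space R {..<n}"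

definition finitely_generated :: "('a, 'b) ring_scheme \<Rightarrow> ('a, 'c, 'd) module_scheme \<Rightarrow> bool" where
  "finitely_generated R M \<longleftrightarrow>
     (\<exists>A. finite A \<and> A \<subseteq> carrier M \<and> module.span R M A = carrier M)"

definition module_iso :: "('a, 'b) ring_scheme \<Rightarrow> ('a, 'c, 'd) module_scheme
    \<Rightarrow> ('a, 'e, 'f) module_scheme \<Rightarrow> bool" where
  "module_iso R M N \<longleftrightarrow> (\<exists>f\<in>module_hom R M N. bij_betw f (carrier M) (carrier N))"

definition ideal_smult :: "('a, 'b) ring_scheme \<Rightarrow> 'a set \<Rightarrow> ('a, 'c, 'd) module_scheme \<Rightarrow> 'c set" where
  "ideal_smult R I M = module.span R M {a \<odot>\<^bsub>M\<^esub> v |a v. a \<in> I \<and> v \<in> carrier M}"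

definition has_free_direct_summand ::
    "('a, 'b) ring_scheme \<Rightarrow> ('a, 'c, 'd) module_scheme \<Rightarrow> bool" where
  "has_free_direct_summand R M \<longleftrightarrow>
     (\<exists>F N n. LinearCombinations.submodule R F M \<and> LinearCombinations.submodule R N M \<and>
        F \<inter> N = {\<zero>\<^bsub>M\<^esub>} \<and> module.submodule_sum M F N = carrier M \<and>
        n \<ge> 1 \<and> module_iso R (M\<lparr>carrier := F\<rparr>) (free_module R n))"


section \<open>Depth and Cohen--Macaulayness\<close>

definition regular_sequence ::
    "('a, 'b) ring_scheme \<Rightarrow> ('a, 'c, 'd) module_scheme \<Rightarrow> 'a list \<Rightarrow> bool" where
  "regular_sequence R M xs \<longleftrightarrow>
     (\<forall>i<length xs.
        let Q = quotient_module M (ideal_smult R (Idl\<^bsub>R\<^esub> (set (take i xs))) M)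
        in \<forall>v\<in>carrier Q. (xs ! i) \<odot>\<^bsub>Q\<^esub> v = \<zero>\<^bsub>Q\<^esub> \<longrightarrow> v = \<zero>\<^bsub>Q\<^esub>) \<and>
     ideal_smult R (Idl\<^bsub>R\<^esub> (set xs)) M \<noteq> carrier M"

definition depth ::
    "('a, 'b) ring_scheme \<Rightarrow> 'a set \<Rightarrow> ('a, 'c, 'd) module_scheme \<Rightarrow> enat" where
  "depth R \<mm> M = Sup {enat (length xs) |xs. set xs \<subseteq> \<mm> \<and> regular_sequence R M xs}"

locale cohen_macaulay_local_ring = noetherian_local_ring +
  assumes depth_eq_dim: "depth R \<mm> (ring_as_module R) = krull_dim R"

definition maximal_cohen_macaulay ::
    "('a, 'b) ring_scheme \<Rightarrow> 'a set \<Rightarrow> ('a, 'c, 'd) module_scheme \<Rightarrow> bool" where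
  "maximal_cohen_macaulay R \<mm> M \<longleftrightarrow>
     module R M \<and> finitely_generated R M \<and>
     (carrier M = {\<zero>\<^bsub>M\<^esub>} \<or> depth R \<mm> M = krull_dim R)"


section \<open>The $\delta$-invariant, the index and the generalized Loewy length\<close>

text \<open>
  The invariants below are infima in \<^typ>\<open>enat\<close>, so an infimum over the empty set is \<open>\<infinity>\<close>
  and otherwise it is the minimum.

  In \<open>delta\<close> the carrier type of \<open>X\<close> has to be fixed. Nothing is lost: every finitely generated
  module is isomorphic to \<open>quotient_module (free_module R k) N\<close> for some \<open>k\<close> and \<open>N\<close>, which has
  the carrier type used here.
\<close>

definition delta ::
    "('a, 'b) ring_scheme \<Rightarrow> 'a set \<Rightarrow> ('a, 'c, 'd) module_scheme \<Rightarrow> enat" where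
  "delta R \<mm> M = Inf {enat n |n. \<exists>X :: ('a, (nat \<Rightarrow> 'a) set) module.
     maximal_cohen_macaulay R \<mm> X \<and> \<not> has_free_direct_summand R X \<and>
     (\<exists>f\<in>module_hom R (direct_sum X (free_module R n)) M.
        f ` carrier (direct_sum X (free_module R n)) = carrier M)}"

definition ring_index :: "('a, 'b) ring_scheme \<Rightarrow> 'a set \<Rightarrow> enat" where
  "ring_index R \<mm> = Inf {enat n |n. n \<ge> 1 \<and>
     delta R \<mm> (quotient_module (ring_as_module R) (ideal_power R \<mm> n)) = 1}"

definition system_of_parameters :: "('a, 'b) ring_scheme \<Rightarrow> 'a set \<Rightarrow> 'a list \<Rightarrow> bool" where
  "system_of_parameters R \<mm> xs \<longleftrightarrow>
     enat (length xs) = krull_dim R \<and> set xs \<subseteq> \<mm> \<and> ideal_radical R (Idl\<^bsub>R\<^esub> (set xs)) = \<mm>"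

definition generalized_loewy_length :: "('a, 'b) ring_scheme \<Rightarrow> 'a set \<Rightarrow> enat" where
  "generalized_loewy_length R \<mm> = Inf {enat n |n. n \<ge> 1 \<and>
     (\<exists>xs. system_of_parameters R \<mm> xs \<and> ideal_power R \<mm> n \<subseteq> Idl\<^bsub>R\<^esub> (set xs))}"


section \<open>Multiplication maps between ideal quotients\<close>

text \<open>The underlying set of \<open>I/J\<close> for ideals \<open>J \<subseteq> I\<close>.\<close>

definition ideal_quotient :: "('a, 'b) ring_scheme \<Rightarrow> 'a set \<Rightarrow> 'a set \<Rightarrow> 'a set set" where
  "ideal_quotient R I J = (\<lambda>a. J +>\<^bsub>R\<^esub> a) ` I"

text \<open>The map \<open>a + J \<mapsto> x a + J'\<close> on cosets, meaningful when \<open>x J \<subseteq> J'\<close>: the union over all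
  representatives \<open>a\<close> is then the single coset \<open>x a + J'\<close>.\<close>

definition induced_mult :: "('a, 'b) ring_scheme \<Rightarrow> 'a \<Rightarrow> 'a set \<Rightarrow> 'a set \<Rightarrow> 'a set" where
  "induced_mult R x J' A = (\<Union>a\<in>A. J' +>\<^bsub>R\<^esub> (x \<otimes>\<^bsub>R\<^esub> a))"

end

theory Submission
  imports Defs
begin

text \<open>
  Write \<open>n = s + t - 1\<close>. The idea is to study the ideal \<open>I = xR + \<mm>^n\<close>, and to show that it is
  principal because otherwise it would, as a maximal Cohen--Macaulay module without free summand,
  map onto \<open>R/\<mm>^s\<close>, contradicting \<open>\<delta>(R/\<mm>^s) = 1\<close>.

  Injectivity of the multiplication maps says that \<open>x a \<in> \<mm>^(n+1)\<close> forces \<open>a \<in> \<mm>^s\<close>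
  (\<open>injective_induced_mult_cancel\<close>), so \<open>R/\<mm>^s\<close> embeds into \<open>I/\<mm>^(n+1)\<close> as the submodule generated
  by \<open>x\<close>. This submodule is a direct summand: inside the vector space \<open>\<mm>^n/\<mm>^(n+1)\<close> its trace has a
  complement, and the preimage \<open>N\<close> of the complement is an ideal with \<open>I = N + xR\<close> that contains
  \<open>x a\<close> only for \<open>a \<in> \<mm>^s\<close> (\<open>exists_complement\<close>). Hence \<open>j + a x \<mapsto> a + \<mm>^s\<close> is a surjection
  \<open>I \<rightarrow> R/\<mm>^s\<close> (\<open>exists_surjection_onto_quotient\<close>).

  In dimension one every ideal containing a nonzerodivisor and contained in \<open>\<mm>\<close> is maximal
  Cohen--Macaulay (\<open>maximal_cohen_macaulay_ideal_copy\<close>), and it has a free direct summand only if it is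
  principal (\<open>free_direct_summand_imp_principal\<close>). So a nonprincipal \<open>I\<close> would give
  \<open>\<delta>(R/\<mm>^s) = 0\<close>.

  Let \<open>y\<close> generate \<open>I\<close>. Either \<open>x\<close> is a generator as well and \<open>\<mm>^n \<subseteq> xR\<close>, or \<open>x \<in> \<mm> y\<close>, and then
  \<open>\<mm>^n = I = yR\<close> by Nakayama's lemma (\<open>principal_sum_cases\<close>). In both cases \<open>\<mm>^n\<close> lies in an ideal
  generated by one nonzerodivisor of \<open>\<mm>\<close>, which is a system of parameters
  (\<open>nonzerodivisor_system_of_parameters\<close>). This is the bound on the generalized Loewy length; and if
  \<open>\<mm>^n\<close> is not principal, only the first case is possible.
\<close>

section \<open>Prime ideals and nonzerodivisors\<close>

lemma (in noetherian_ring) exists_maximal_ideal_with: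
  assumes "ideal I R" and "P I"
  obtains J where "ideal J R" "I \<subseteq> J" "P J"
    "\<And>K. ideal K R \<Longrightarrow> J \<subseteq> K \<Longrightarrow> P K \<Longrightarrow> K = J"
proof -
  let ?A = "{J. ideal J R \<and> I \<subseteq> J \<and> P J}"
  have "\<exists>M\<in>?A. \<forall>X\<in>?A. M \<subseteq> X \<longrightarrow> X = M"
  proof (rule subset_Zorn_nonempty)
    show "?A \<noteq> {}" using assms by blast
    fix C assume C: "C \<noteq> {}" "subset.chain ?A C"
    then have "subset.chain {J. ideal J R} C"
      unfolding pred_on.chain_def by blast
    with C(1) have "\<Union>C \<in> C" by (rule ideal_chain_is_trivial)
    with C(2) show "\<Union>C \<in> ?A" unfolding pred_on.chain_def by blast
  qed
  then obtain M where M: "M \<in> ?A" "\<forall>X\<in>?A. M \<subseteq> X \<longrightarrow> X = M" by (elim bexE)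
  show thesis
  proof (rule that[of M])
    fix K assume K: "ideal K R" "M \<subseteq> K" "P K"
    then have "K \<in> ?A" using M(1) by auto
    then show "K = M" using M(2) K(2) by simp
  qed (use M(1) in auto)
qed

lemma (in cring) mem_add_PIdl:
  "u \<in> J <+>\<^bsub>R\<^esub> PIdl a \<longleftrightarrow> (\<exists>j\<in>J. \<exists>r\<in>carrier R. u = j \<oplus> r \<otimes> a)"
  unfolding set_add_def' cgenideal_def by blast

lemma (in cring) add_PIdl:
  assumes "ideal J R" "a \<in> carrier R"
  shows "ideal (J <+>\<^bsub>R\<^esub> PIdl a) R" "J \<subseteq> J <+>\<^bsub>R\<^esub> PIdl a" "a \<in> J <+>\<^bsub>R\<^esub> PIdl a"
proof -
  interpret J: ideal J R by fact
  show "ideal (J <+>\<^bsub>R\<^esub> PIdl a) R" using assms by (simp add: add_ideals cgenideal_ideal)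
  show "J \<subseteq> J <+>\<^bsub>R\<^esub> PIdl a"
  proof
    fix j assume "j \<in> J"
    moreover have "j = j \<oplus> \<zero> \<otimes> a" using \<open>j \<in> J\<close> assms by simp
    ultimately show "j \<in> J <+>\<^bsub>R\<^esub> PIdl a" unfolding mem_add_PIdl by blast
  qed
  have "a = \<zero> \<oplus> \<one> \<otimes> a" using assms by simp
  then show "a \<in> J <+>\<^bsub>R\<^esub> PIdl a" unfolding mem_add_PIdl using J.zero_closed by blast
qed

lemma (in cring) add_PIdl_subset:
  assumes "ideal I R" "J \<subseteq> I" "a \<in> I"
  shows "J <+>\<^bsub>R\<^esub> PIdl a \<subseteq> I"
proof
  interpret I: ideal I R by fact
  fix u assume "u \<in> J <+>\<^bsub>R\<^esub> PIdl a"
  then obtain j r where "j \<in> J" "r \<in> carrier R" "u = j \<oplus> r \<otimes> a"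
    unfolding mem_add_PIdl by (elim bexE)
  then show "u \<in> I" using assms I.a_closed I.I_l_closed by (simp add: subsetD)
qed

text \<open>An ideal maximal among those missing a multiplicative set is prime.\<close>

lemma (in cring) exists_prime_avoiding:
  assumes "noetherian_ring R" and I: "ideal I R" and S: "S \<subseteq> carrier R" "S \<noteq> {}"
    and mult: "\<And>a b. a \<in> S \<Longrightarrow> b \<in> S \<Longrightarrow> a \<otimes> b \<in> S"
    and disj: "I \<inter> S = {}"
  obtains P where "primeideal P R" "I \<subseteq> P" "P \<inter> S = {}"
proof -
  interpret noetherian_ring R by fact
  obtain P where P: "ideal P R" "I \<subseteq> P" "P \<inter> S = {}"
    and max: "\<And>K. ideal K R \<Longrightarrow> P \<subseteq> K \<Longrightarrow> K \<inter> S = {} \<Longrightarrow> K = P"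
    using exists_maximal_ideal_with[OF I, of "\<lambda>J. J \<inter> S = {}"] disj by blast
  interpret P: ideal P R by fact
  have "primeideal P R"
  proof (rule primeidealI[OF P(1) is_cring])
    show "carrier R \<noteq> P" using P(3) S by blast
    fix a b assume ab: "a \<in> carrier R" "b \<in> carrier R" "a \<otimes> b \<in> P"
    show "a \<in> P \<or> b \<in> P"
    proof (rule ccontr)
      assume n: "\<not> (a \<in> P \<or> b \<in> P)"
      have meets: "\<exists>u\<in>S. u \<in> P <+>\<^bsub>R\<^esub> PIdl c" if "c \<in> carrier R" "c \<notin> P" for c
        using max[of "P <+>\<^bsub>R\<^esub> PIdl c"] add_PIdl[OF P(1) that(1)] that(2) by blast
      obtain p r where p: "p \<in> P" "r \<in> carrier R" "p \<oplus> r \<otimes> a \<in> S"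
        using meets[of a] ab n unfolding mem_add_PIdl by blast
      obtain q u where q: "q \<in> P" "u \<in> carrier R" "q \<oplus> u \<otimes> b \<in> S"
        using meets[of b] ab n unfolding mem_add_PIdl by blast
      have "(p \<oplus> r \<otimes> a) \<otimes> (q \<oplus> u \<otimes> b) =
          p \<otimes> (q \<oplus> u \<otimes> b) \<oplus> ((r \<otimes> a) \<otimes> q \<oplus> (r \<otimes> u) \<otimes> (a \<otimes> b))"
        using p q ab P.Icarr[OF p(1)] P.Icarr[OF q(1)] by (simp add: l_distr r_distr m_ac a_ac)
      also have "\<dots> \<in> P"
        using p q ab P.Icarr[OF q(1)]
        by (intro P.a_closed P.I_r_closed[OF p(1)] P.I_l_closed[OF q(1)] P.I_l_closed[OF ab(3)]) auto
      finally show False using mult[OF p(3) q(3)] P(3) by blast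
    qed
  qed
  then show thesis using that P by blast
qed

lemma (in cring) nonzerodivisor_pow_mult:
  assumes "nonzerodivisor R x" "y \<in> carrier R" "x [^] (k::nat) \<otimes> y = \<zero>"
  shows "y = \<zero>"
  using assms(2,3)
proof (induct k arbitrary: y)
  case (Suc k)
  have x: "x \<in> carrier R" using assms(1) unfolding nonzerodivisor_def by blast
  have "x [^] k \<otimes> (x \<otimes> y) = \<zero>" using Suc(2,3) x by (simp add: m_assoc)
  then have "x \<otimes> y = \<zero>" using Suc(1)[of "x \<otimes> y"] Suc(2) x by simp
  then show ?case using assms(1) Suc(2) unfolding nonzerodivisor_def by blast
qed simp

text \<open>
  A prime avoiding all products \<open>x^k u\<close> with \<open>u \<notin> P\<close> lies inside \<open>P\<close> and misses \<open>x\<close>. Such a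
  prime exists because no such product is zero, \<open>x\<close> being a nonzerodivisor. This is the argument
  in the localization at \<open>P\<close>, carried out in \<open>R\<close>.
\<close>

lemma (in cring) prime_containing_nonzerodivisor_not_minimal:
  assumes "noetherian_ring R" and P: "primeideal P R" and x: "nonzerodivisor R x" "x \<in> P"
  obtains Q where "primeideal Q R" "Q \<subset> P"
proof -
  interpret P: primeideal P R by fact
  have xR: "x \<in> carrier R" using x(2) P.Icarr by blast
  define S where "S = {x [^] k \<otimes> u |(k::nat) u. u \<in> carrier R - P}"
  have one: "\<one> \<in> carrier R - P" using P.one_imp_carrier P.I_notcarr by blast
  have disj: "{\<zero>} \<inter> S = {}"
  proof -
    have "\<zero> \<notin> S"
    proof
      assume "\<zero> \<in> S"
      then obtain k :: nat and u where u: "\<zero> = x [^] k \<otimes> u" "u \<in> carrier R - P"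
        unfolding S_def by blast
      have "u = \<zero>" using nonzerodivisor_pow_mult[OF x(1) _ u(1)[symmetric]] u(2) by blast
      then show False using u(2) P.zero_closed by blast
    qed
    then show ?thesis by blast
  qed
  have sub: "S \<subseteq> carrier R" unfolding S_def using xR by auto
  have ne: "S \<noteq> {}" unfolding S_def using one by blast
  have mult: "a \<otimes> b \<in> S" if ab: "a \<in> S" "b \<in> S" for a b
  proof -
    obtain k l :: nat and u v where a: "a = x [^] k \<otimes> u" "u \<in> carrier R - P"
      and b: "b = x [^] l \<otimes> v" "v \<in> carrier R - P" using ab unfolding S_def by blast
    have "x [^] k \<otimes> u \<otimes> (x [^] l \<otimes> v) = (x [^] k \<otimes> x [^] l) \<otimes> (u \<otimes> v)"
      using a(2) b(2) xR by (simp add: m_ac)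
    then have "a \<otimes> b = x [^] (k + l) \<otimes> (u \<otimes> v)"
      using a(1) b(1) by (simp add: nat_pow_mult[OF xR])
    moreover have "u \<otimes> v \<in> carrier R - P" using a(2) b(2) P.I_prime by blast
    ultimately show ?thesis unfolding S_def by blast
  qed
  obtain Q where Q: "primeideal Q R" "Q \<inter> S = {}"
    by (rule exists_prime_avoiding[OF assms(1) zeroideal sub ne mult disj])
  interpret Q: primeideal Q R by fact
  have "Q \<subseteq> P"
  proof
    fix u assume u: "u \<in> Q"
    have "x [^] (0::nat) \<otimes> u \<in> S" if "u \<notin> P" unfolding S_def using that Q.Icarr[OF u] by blast
    then have "u \<in> S" if "u \<notin> P" using that Q.Icarr[OF u] by simp
    then show "u \<in> P" using u Q(2) by blast
  qed
  moreover have "x [^] (1::nat) \<otimes> \<one> \<in> S" unfolding S_def using one by blast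
  then have "x \<in> S" using xR by simp
  then have "x \<notin> Q" using Q(2) by blast
  ultimately show thesis using that[OF Q(1)] x(2) by blast
qed

section \<open>One-dimensional local rings\<close>

context noetherian_local_ring
begin

lemma maximalideal_mm: "maximalideal \<mm> R"
  using unique_maximal by blast

lemma ideal_mm: "ideal \<mm> R"
  using maximalideal.axioms(1)[OF maximalideal_mm] .

lemma primeideal_mm: "primeideal \<mm> R"
  by (rule maximalideal_prime[OF maximalideal_mm])

lemma one_not_in_mm: "\<one> \<notin> \<mm>"
  using ideal.one_imp_carrier[OF ideal_mm] maximalideal.I_notcarr[OF maximalideal_mm] by blast

lemma proper_ideal_subset_mm:
  assumes "ideal I R" "\<one> \<notin> I"
  shows "I \<subseteq> \<mm>"
proof -
  obtain J where J: "ideal J R" "I \<subseteq> J" "\<one> \<notin> J"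
    and max: "\<And>K. ideal K R \<Longrightarrow> J \<subseteq> K \<Longrightarrow> \<one> \<notin> K \<Longrightarrow> K = J"
    using exists_maximal_ideal_with[OF assms(1), of "\<lambda>J. \<one> \<notin> J"] assms(2) by blast
  have "maximalideal J R"
  proof (rule maximalidealI[OF J(1)])
    show "carrier R \<noteq> J" using J(3) by blast
    fix K assume "ideal K R" "J \<subseteq> K"
    then show "K = J \<or> K = carrier R" using max ideal.one_imp_carrier by blast
  qed
  then have "J = \<mm>" using unique_maximal by blast
  then show ?thesis using J(2) by blast
qed

lemma unit_if_not_in_mm:
  assumes "a \<in> carrier R" "a \<notin> \<mm>"
  obtains b where "b \<in> carrier R" "b \<otimes> a = \<one>"
proof -
  have "\<not> PIdl a \<subseteq> \<mm>" using cgenideal_self[OF assms(1)] assms(2) by (meson subsetD)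
  then have "\<one> \<in> PIdl a"
    using proper_ideal_subset_mm[OF cgenideal_ideal[OF assms(1)]] by (rule contrapos_np)
  then obtain b where "\<one> = b \<otimes> a" "b \<in> carrier R"
    unfolding cgenideal_def mem_Collect_eq by (elim exE conjE)
  then show thesis using that[of b] by simp
qed

text \<open>
  A prime strictly below \<open>\<mm>\<close> that contains a nonzerodivisor has another prime strictly below it, and
  the three primes form a chain too long for dimension one.
\<close>

lemma prime_containing_nonzerodivisor:
  assumes dim: "krull_dim R = 1" and P: "primeideal P R" and x: "nonzerodivisor R x" "x \<in> P"
  shows "P = \<mm>"
proof (rule ccontr)
  assume "P \<noteq> \<mm>"
  interpret P: primeideal P R by fact
  have "P \<subseteq> \<mm>"
    using proper_ideal_subset_mm[OF P.is_ideal] P.one_imp_carrier P.I_notcarr by blast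
  with \<open>P \<noteq> \<mm>\<close> have "P \<subset> \<mm>" by blast
  obtain Q where Q: "primeideal Q R" "Q \<subset> P"
    using prime_containing_nonzerodivisor_not_minimal[OF noetherian_ring_axioms P x] by blast
  define C where "C i = (if i = 0 then Q else if i = 1 then P else \<mm>)" for i :: nat
  have "(\<forall>i\<le>2. primeideal (C i) R) \<and> (\<forall>i<2. C i \<subset> C (Suc i))"
    using Q P primeideal_mm \<open>P \<subset> \<mm>\<close> unfolding C_def by auto
  then have "enat 2 \<in> {enat n |n. \<exists>P. (\<forall>i\<le>n. primeideal (P i) R) \<and> (\<forall>i<n. P i \<subset> P (Suc i))}"
    by blast
  then have "enat 2 \<le> krull_dim R" unfolding krull_dim_def by (rule Sup_upper)
  then show False using dim by (simp add: one_enat_def)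
qed

text \<open>
  Otherwise some prime contains \<open>x\<close> and misses every power of \<open>a\<close>, whereas \<open>\<mm>\<close> is the only prime
  containing \<open>x\<close>.
\<close>

lemma power_in_PIdl_nonzerodivisor:
  assumes dim: "krull_dim R = 1" and x: "nonzerodivisor R x" "x \<in> \<mm>" and a: "a \<in> \<mm>"
  obtains k :: nat where "a [^] k \<in> PIdl x"
proof -
  have carr: "x \<in> carrier R" "a \<in> carrier R" using x a ideal.Icarr[OF ideal_mm] by auto
  define S where "S = range (\<lambda>k::nat. a [^] k)"
  have "PIdl x \<inter> S \<noteq> {}"
  proof
    assume disj: "PIdl x \<inter> S = {}"
    have sub: "S \<subseteq> carrier R" unfolding S_def using carr(2) by auto
    have ne: "S \<noteq> {}" unfolding S_def by simp
    have mult: "u \<otimes> v \<in> S" if uv: "u \<in> S" "v \<in> S" for u v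
    proof -
      obtain k l :: nat where "u = a [^] k" "v = a [^] l" using uv unfolding S_def by blast
      then have "u \<otimes> v = a [^] (k + l)" using nat_pow_mult[OF carr(2)] by simp
      then show ?thesis unfolding S_def by simp
    qed
    obtain P where P: "primeideal P R" "PIdl x \<subseteq> P" "P \<inter> S = {}"
      by (rule exists_prime_avoiding[OF noetherian_ring_axioms cgenideal_ideal[OF carr(1)] sub ne mult disj])
    have "x \<in> P" using P(2) cgenideal_self[OF carr(1)] by (rule subsetD)
    then have "P = \<mm>" by (rule prime_containing_nonzerodivisor[OF dim P(1) x(1)])
    moreover have "a [^] (1::nat) \<in> S" unfolding S_def by (rule rangeI)
    then have "a \<in> S" using carr(2) by simp
    ultimately show False using P(3) a by (simp add: disjoint_iff)
  qed
  then show thesis using that unfolding S_def by auto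
qed

lemma nonzerodivisor_system_of_parameters:
  assumes dim: "krull_dim R = 1" and x: "nonzerodivisor R x" "x \<in> \<mm>"
  shows "system_of_parameters R \<mm> [x]"
proof -
  interpret \<mm>: primeideal \<mm> R by (rule primeideal_mm)
  have xR: "x \<in> carrier R" using x(2) by (rule \<mm>.Icarr)
  have "ideal_radical R (PIdl x) = \<mm>"
  proof
    show "\<mm> \<subseteq> ideal_radical R (PIdl x)"
      unfolding ideal_radical_def using power_in_PIdl_nonzerodivisor[OF dim x] \<mm>.Icarr by blast
    show "ideal_radical R (PIdl x) \<subseteq> \<mm>"
    proof
      fix a assume "a \<in> ideal_radical R (PIdl x)"
      then obtain k :: nat where a: "a \<in> carrier R" "a [^] k \<in> PIdl x"
        unfolding ideal_radical_def by blast
      have "a [^] k \<in> \<mm>" using a(2) cgenideal_minimal[OF ideal_mm x(2)] by blast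
      then show "a \<in> \<mm>"
      proof (induct k)
        case 0 then show ?case using one_not_in_mm by simp
      next
        case (Suc k) then show ?case using \<mm>.I_prime[of "a [^] k" a] a(1) by auto
      qed
    qed
  qed
  then show ?thesis
    unfolding system_of_parameters_def
    using dim x(2) xR by (simp add: cgenideal_eq_genideal one_enat_def)
qed

lemma ideal_power_ideal: "ideal (ideal_power R \<mm> n) R"
  by (induct n) (simp_all add: oneideal ideal_prod_is_ideal ideal_mm)

lemma ideal_power_Suc_subset: "ideal_power R \<mm> (Suc n) \<subseteq> ideal_power R \<mm> n"
  using ideal_prod_inter[OF ideal_mm ideal_power_ideal[of n]] by simp

lemma ideal_power_antimono: "k \<le> n \<Longrightarrow> ideal_power R \<mm> n \<subseteq> ideal_power R \<mm> k"
  by (rule lift_Suc_antimono_le[of "ideal_power R \<mm>"]) (rule ideal_power_Suc_subset)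

lemma ideal_power_subset_mm:
  assumes "n \<ge> 1"
  shows "ideal_power R \<mm> n \<subseteq> \<mm>"
  using assms ideal_prod_inter[OF ideal_mm ideal_power_ideal] by (cases n) auto

lemma ideal_power_mult:
  assumes "a \<in> ideal_power R \<mm> k" "b \<in> ideal_power R \<mm> n"
  shows "a \<otimes> b \<in> ideal_power R \<mm> (k + n)"
  using assms(1)
proof (induct k arbitrary: a)
  case 0
  then show ?case using ideal.I_l_closed[OF ideal_power_ideal assms(2)] by simp
next
  case (Suc k)
  have b: "b \<in> carrier R" using assms(2) ideal.Icarr[OF ideal_power_ideal] by blast
  interpret T: ideal "ideal_power R \<mm> (Suc k + n)" R by (rule ideal_power_ideal)
  from Suc(2) have "a \<in> \<mm> \<cdot> ideal_power R \<mm> k" by simp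
  then have "a \<in> carrier R \<and> a \<otimes> b \<in> ideal_power R \<mm> (Suc k + n)"
  proof (induct rule: ideal_prod.induct)
    case (prod i j)
    have c: "i \<in> carrier R" "j \<in> carrier R"
      using prod ideal.Icarr[OF ideal_mm] ideal.Icarr[OF ideal_power_ideal] by auto
    have "i \<otimes> (j \<otimes> b) \<in> ideal_power R \<mm> (Suc k + n)"
      using ideal_prod.prod[OF prod(1) Suc(1)[OF prod(2)], of R] by simp
    then show ?case using c b by (simp add: m_assoc)
  next
    case (sum u v)
    then show ?case using b T.a_closed by (simp add: l_distr)
  qed
  then show ?case by blast
qed

section \<open>The ideal generated by the element and a power of the maximal ideal\<close>

lemma induced_mult_coset:
  assumes x: "x \<in> ideal_power R \<mm> t" and a: "a \<in> carrier R"
  shows "induced_mult R x (ideal_power R \<mm> (i + t)) (ideal_power R \<mm> i +> a)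
    = ideal_power R \<mm> (i + t) +> x \<otimes> a"
proof -
  interpret I: ideal "ideal_power R \<mm> i" R by (rule ideal_power_ideal)
  interpret J: ideal "ideal_power R \<mm> (i + t)" R by (rule ideal_power_ideal)
  have xR: "x \<in> carrier R" using x ideal.Icarr[OF ideal_power_ideal] by blast
  have "ideal_power R \<mm> (i + t) +> x \<otimes> b = ideal_power R \<mm> (i + t) +> x \<otimes> a"
    if b: "b \<in> ideal_power R \<mm> i +> a" for b
  proof -
    obtain j where j: "j \<in> ideal_power R \<mm> i" "b = j \<oplus> a"
      using b unfolding a_r_coset_def' by blast
    have "x \<otimes> b \<ominus> x \<otimes> a = x \<otimes> j"
      using j I.Icarr[OF j(1)] xR a by (simp add: r_distr a_minus_def a_assoc r_neg)
    also have "\<dots> \<in> ideal_power R \<mm> (i + t)"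
      using ideal_power_mult[OF x j(1)] by (simp add: add.commute)
    finally show ?thesis
      using quotient_eq_iff_same_a_r_cos[OF J.is_ideal] xR a j(2) I.Icarr[OF j(1)] by simp
  qed
  then show ?thesis
    unfolding induced_mult_def using I.a_rcos_self[OF a] by blast
qed

text \<open>
  Injectivity in degree \<open>i\<close> moves \<open>a\<close> from \<open>\<mm>^(i-1)\<close> into \<open>\<mm>^i\<close>: since \<open>x a \<in> \<mm>^(i+t)\<close>, the
  classes of \<open>a\<close> and of \<open>0\<close> have the same image. Thus a multiple \<open>x a\<close> lies in
  \<open>\<mm>^(s+t)\<close> only if \<open>a \<in> \<mm>^s\<close>.
\<close>

lemma injective_induced_mult_cancel:
  assumes x: "x \<in> ideal_power R \<mm> t"
    and inj: "\<forall>i. 1 \<le> i \<and> i \<le> s \<longrightarrow>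
      inj_on (induced_mult R x (ideal_power R \<mm> (i + t)))
        (ideal_quotient R (ideal_power R \<mm> (i - 1)) (ideal_power R \<mm> i))"
    and a: "a \<in> carrier R" "x \<otimes> a \<in> ideal_power R \<mm> (s + t)"
  shows "a \<in> ideal_power R \<mm> s"
proof -
  have xR: "x \<in> carrier R" using x ideal.Icarr[OF ideal_power_ideal] by blast
  have "i \<le> s \<longrightarrow> a \<in> ideal_power R \<mm> i" for i
  proof (induct i)
    case (Suc i)
    show ?case
    proof
      assume le: "Suc i \<le> s"
      interpret I: ideal "ideal_power R \<mm> (Suc i)" R by (rule ideal_power_ideal)
      interpret J: ideal "ideal_power R \<mm> (Suc i + t)" R by (rule ideal_power_ideal)
      let ?c = "\<lambda>b. ideal_power R \<mm> (Suc i) +> b"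
      have "x \<otimes> a \<in> ideal_power R \<mm> (Suc i + t)"
        using a(2) ideal_power_antimono[of "Suc i + t" "s + t"] le by auto
      then have "ideal_power R \<mm> (Suc i + t) +> x \<otimes> a = ideal_power R \<mm> (Suc i + t) +> x \<otimes> \<zero>"
        using J.a_rcos_const J.zero_closed xR by (metis r_null)
      then have eq: "induced_mult R x (ideal_power R \<mm> (Suc i + t)) (?c a)
          = induced_mult R x (ideal_power R \<mm> (Suc i + t)) (?c \<zero>)"
        using induced_mult_coset[OF x a(1), of "Suc i"]
          induced_mult_coset[OF x zero_closed, of "Suc i"] by metis
      have inj_i: "inj_on (induced_mult R x (ideal_power R \<mm> (Suc i + t)))
          (ideal_quotient R (ideal_power R \<mm> i) (ideal_power R \<mm> (Suc i)))"
        using inj[rule_format, of "Suc i"] le by (simp only: diff_Suc_1) simp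
      have "a \<in> ideal_power R \<mm> i" using Suc le by simp
      then have mem: "?c a \<in> ideal_quotient R (ideal_power R \<mm> i) (ideal_power R \<mm> (Suc i))"
        "?c \<zero> \<in> ideal_quotient R (ideal_power R \<mm> i) (ideal_power R \<mm> (Suc i))"
        unfolding ideal_quotient_def
        using additive_subgroup.zero_closed[OF ideal.axioms(1)[OF ideal_power_ideal]] by auto
      have "?c a = ?c \<zero>" by (rule inj_onD[OF inj_i eq mem])
      then have "?c a = ideal_power R \<mm> (Suc i)" using I.a_rcos_const[OF I.zero_closed] by simp
      then show "a \<in> ideal_power R \<mm> (Suc i)" using I.rcos_const_imp_mem a(1) by blast
    qed
  qed (simp add: a(1))
  then show ?thesis by blast
qed

text \<open>
  Modulo \<open>\<mm>^(n+1)\<close>, the ideal \<open>N\<close> is to be a complement, in the vector space \<open>\<mm>^n/\<mm>^(n+1)\<close>, of the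
  part coming from \<open>xR\<close>. It is taken maximal among the ideals between \<open>\<mm>^(n+1)\<close> and \<open>\<mm>^n\<close> that
  contain \<open>x a\<close> only for \<open>a \<in> K\<close>. If \<open>w \<in> \<mm>^n\<close> is not in \<open>N\<close>, then by maximality
  \<open>N + wR\<close> contains some \<open>x a = j + r w\<close> with \<open>j \<in> N\<close> and \<open>a \<notin> K\<close>; here \<open>r\<close> is a unit, because
  \<open>\<mm> w \<subseteq> N\<close>, and so \<open>w \<in> N + xR\<close>.
\<close>

lemma exists_complement:
  assumes xR: "x \<in> carrier R"
    and cancel: "\<And>a. a \<in> carrier R \<Longrightarrow> x \<otimes> a \<in> ideal_power R \<mm> (Suc n) \<Longrightarrow> a \<in> K"
  obtains N where "ideal N R" "N \<subseteq> ideal_power R \<mm> n"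
    "ideal_power R \<mm> n \<subseteq> N <+>\<^bsub>R\<^esub> PIdl x"
    "\<forall>a\<in>carrier R. x \<otimes> a \<in> N \<longrightarrow> a \<in> K"
proof -
  let ?P = "\<lambda>N. N \<subseteq> ideal_power R \<mm> n \<and> (\<forall>a\<in>carrier R. x \<otimes> a \<in> N \<longrightarrow> a \<in> K)"
  have P0: "?P (ideal_power R \<mm> (Suc n))" using ideal_power_Suc_subset cancel by blast
  obtain N where N: "ideal N R" "ideal_power R \<mm> (Suc n) \<subseteq> N" "?P N"
    and max: "\<And>K. ideal K R \<Longrightarrow> N \<subseteq> K \<Longrightarrow> ?P K \<Longrightarrow> K = N"
    using exists_maximal_ideal_with[of "ideal_power R \<mm> (Suc n)" ?P, OF ideal_power_ideal P0]
    by blast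
  interpret N: ideal N R by fact
  interpret M: ideal "ideal_power R \<mm> n" R by (rule ideal_power_ideal)
  have "ideal_power R \<mm> n \<subseteq> N <+>\<^bsub>R\<^esub> PIdl x"
  proof
    fix w assume w: "w \<in> ideal_power R \<mm> n"
    have wR: "w \<in> carrier R" using w by (rule M.Icarr)
    show "w \<in> N <+>\<^bsub>R\<^esub> PIdl x"
    proof (cases "w \<in> N")
      case True then show ?thesis using add_PIdl(2)[OF N(1) xR] by blast
    next
      case False
      have "N <+>\<^bsub>R\<^esub> PIdl w \<subseteq> ideal_power R \<mm> n"
        using add_PIdl_subset[OF M.is_ideal _ w] N(3) by blast
      with False max[of "N <+>\<^bsub>R\<^esub> PIdl w"] add_PIdl[OF N(1) wR]
      obtain a where a: "a \<in> carrier R" "x \<otimes> a \<in> N <+>\<^bsub>R\<^esub> PIdl w" "a \<notin> K" by blast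
      then obtain j r where j: "j \<in> N" "r \<in> carrier R" "x \<otimes> a = j \<oplus> r \<otimes> w"
        unfolding mem_add_PIdl by blast
      have jR: "j \<in> carrier R" using j(1) by (rule N.Icarr)
      have "r \<notin> \<mm>"
      proof
        assume "r \<in> \<mm>"
        then have "r \<otimes> w \<in> N" using ideal_prod.prod[OF _ w, of r \<mm> R] N(2) by auto
        then have "x \<otimes> a \<in> N" using j N.a_closed by simp
        then show False using N(3) a by blast
      qed
      then obtain u where u: "u \<in> carrier R" "u \<otimes> r = \<one>"
        using unit_if_not_in_mm[OF j(2)] by blast
      have "w = (u \<otimes> r) \<otimes> w" using u wR by simp
      also have "\<dots> = u \<otimes> (r \<otimes> w)" using u(1) j(2) wR by (simp add: m_assoc)
      also have "r \<otimes> w = \<ominus> j \<oplus> x \<otimes> a"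
        using j jR wR by (simp add: a_assoc[symmetric] l_neg)
      also have "u \<otimes> (\<ominus> j \<oplus> x \<otimes> a) = u \<otimes> \<ominus> j \<oplus> (u \<otimes> a) \<otimes> x"
        using u(1) jR a(1) xR by (simp add: r_distr m_ac)
      finally show ?thesis
        unfolding mem_add_PIdl
        using N.I_l_closed[OF N.a_inv_closed[OF j(1)] u(1)] u(1) a(1) by blast
    qed
  qed
  then show thesis using that[of N] N by blast
qed

text \<open>
  Let \<open>y\<close> generate \<open>N + xR\<close> and write \<open>x = r y\<close>. If \<open>r\<close> is a unit, then \<open>x\<close> generates the ideal too.
  If \<open>r \<in> \<mm>\<close>, then \<open>x\<close> is superfluous as a generator, as in Nakayama's lemma: \<open>y = j + c r y\<close> with
  \<open>j \<in> N\<close> makes \<open>y\<close> a unit multiple of \<open>j\<close>, so the ideal equals \<open>N\<close> and hence \<open>J\<close>.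
\<close>

lemma principal_sum_cases:
  assumes x: "x \<in> carrier R" and N: "ideal N R" and J: "ideal J R" "N \<subseteq> J"
    and JI: "J \<subseteq> N <+>\<^bsub>R\<^esub> PIdl x" and princ: "principalideal (N <+>\<^bsub>R\<^esub> PIdl x) R"
  obtains "J \<subseteq> PIdl x"
    | y where "y \<in> carrier R" "J = PIdl y" "x \<in> PIdl y"
proof -
  interpret N: ideal N R by fact
  obtain y where y: "y \<in> carrier R" "N <+>\<^bsub>R\<^esub> PIdl x = Idl {y}"
    using principalideal.generate[OF princ] by (elim bexE)
  have I: "N <+>\<^bsub>R\<^esub> PIdl x = PIdl y" using y by (simp add: cgenideal_eq_genideal)
  have "x \<in> PIdl y" using add_PIdl(3)[OF N x] unfolding I .
  then obtain r where r: "x = r \<otimes> y" "r \<in> carrier R"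
    unfolding cgenideal_def mem_Collect_eq by (elim exE conjE)
  show thesis
  proof (cases "r \<in> \<mm>")
    case False
    then obtain u where u: "u \<in> carrier R" "u \<otimes> r = \<one>" using unit_if_not_in_mm[OF r(2)] by blast
    have "y = u \<otimes> x" using u r y(1) by (simp add: m_assoc[symmetric])
    also have "\<dots> \<in> PIdl x" unfolding cgenideal_def using u(1) by blast
    finally have "PIdl y \<subseteq> PIdl x" by (rule cgenideal_minimal[OF cgenideal_ideal[OF x]])
    then show thesis using that(1) JI unfolding I by (meson subset_trans)
  next
    case True
    have "y \<in> N <+>\<^bsub>R\<^esub> PIdl x" unfolding I using y(1) by (rule cgenideal_self)
    then obtain j c where j: "j \<in> N" "c \<in> carrier R" "y = j \<oplus> c \<otimes> x"
      unfolding mem_add_PIdl by (elim bexE)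
    have jR: "j \<in> carrier R" using j(1) by (rule N.Icarr)
    have cr: "c \<otimes> r \<in> \<mm>" using ideal.I_l_closed[OF ideal_mm True j(2)] .
    let ?w = "\<one> \<ominus> c \<otimes> r"
    have wR: "?w \<in> carrier R" using j(2) r(2) by simp
    have "?w \<notin> \<mm>"
    proof
      assume w: "?w \<in> \<mm>"
      have "?w \<oplus> c \<otimes> r = \<one>" using j(2) r(2) by algebra
      then show False
        using additive_subgroup.a_closed[OF ideal.axioms(1)[OF ideal_mm] w cr] one_not_in_mm by simp
    qed
    then obtain v where v: "v \<in> carrier R" "v \<otimes> ?w = \<one>" using unit_if_not_in_mm[OF wR] by blast
    have "?w \<otimes> y = y \<ominus> c \<otimes> x" unfolding r(1) using j(2) r(2) y(1) by algebra
    also have "\<dots> = (j \<oplus> c \<otimes> x) \<ominus> c \<otimes> x" using j(3) by simp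
    also have "\<dots> = j" using jR j(2) x by algebra
    finally have "v \<otimes> j = v \<otimes> (?w \<otimes> y)" by simp
    also have "\<dots> = y" using v y(1) wR by (simp add: m_assoc[symmetric])
    finally have "y \<in> N" using N.I_l_closed[OF j(1) v(1)] by simp
    then have "PIdl y \<subseteq> J" using cgenideal_minimal[OF J(1)] J(2) by (simp add: subsetD)
    then have "J = PIdl y" using JI unfolding I by (rule subset_antisym[rotated])
    then show thesis using that(2)[OF y(1)] \<open>x \<in> PIdl y\<close> by simp
  qed
qed

end

section \<open>Quotient modules and regular sequences\<close>

lemma (in ring) genideal_subset_carrier:
  assumes "S \<subseteq> carrier R"
  shows "Idl S \<subseteq> carrier R"
  by (rule subsetI) (rule ideal.Icarr[OF genideal_ideal[OF assms]])

context module
begin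

lemma is_module: "module R M" by unfold_locales

lemma submodule_abelian_subgroup:
  assumes "LinearCombinations.submodule R N M"
  shows "abelian_subgroup N M"
proof (rule abelian_subgroupI3)
  interpret N: LinearCombinations.submodule R N M by fact
  show "abelian_group M" by (rule M.abelian_group_axioms)
  show "additive_subgroup N M"
  proof (rule additive_subgroup.intro)
    show "subgroup N (add_monoid M)"
    proof
      fix v assume v: "v \<in> N"
      have "\<ominus>\<^bsub>M\<^esub> v = (\<ominus> \<one>) \<odot>\<^bsub>M\<^esub> v" using v N.subset by (simp add: smult_minus_1 subsetD)
      also have "\<dots> \<in> N" using v by simp
      finally show "inv\<^bsub>add_monoid M\<^esub> v \<in> N" unfolding a_inv_def .
    qed (use N.subset in auto)
  qed
qed

context
  fixes N assumes sub: "LinearCombinations.submodule R N M"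
begin

interpretation N: LinearCombinations.submodule R N M by (rule sub)
interpretation N: abelian_subgroup N M by (rule submodule_abelian_subgroup[OF sub])

lemma coset_eq_iff:
  assumes "v \<in> carrier M" "w \<in> carrier M"
  shows "N +>\<^bsub>M\<^esub> v = N +>\<^bsub>M\<^esub> w \<longleftrightarrow> v \<ominus>\<^bsub>M\<^esub> w \<in> N"
proof -
  have "N +>\<^bsub>M\<^esub> v = N +>\<^bsub>M\<^esub> w \<longleftrightarrow> v \<in> N +>\<^bsub>M\<^esub> w"
    using N.a_repr_independence'[OF _ assms(2)] N.a_repr_independenceD[OF assms(1)] by metis
  also have "\<dots> \<longleftrightarrow> v \<ominus>\<^bsub>M\<^esub> w \<in> N"
    using N.a_rcos_module[OF assms(2,1)] unfolding a_minus_def .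
  finally show ?thesis .
qed

lemma coset_eq_submodule_iff:
  assumes "v \<in> carrier M"
  shows "N +>\<^bsub>M\<^esub> v = N \<longleftrightarrow> v \<in> N"
  using N.a_rcos_const N.a_rcos_self[OF assms] by metis

lemma quotient_module_carrier:
  "carrier (quotient_module M N) = (\<lambda>v. N +>\<^bsub>M\<^esub> v) ` carrier M"
  unfolding quotient_module_def A_RCOSETS_def' by auto

lemma quotient_module_zero: "\<zero>\<^bsub>quotient_module M N\<^esub> = N"
  unfolding quotient_module_def by simp

lemma quotient_module_add:
  assumes "v \<in> carrier M" "w \<in> carrier M"
  shows "(N +>\<^bsub>M\<^esub> v) \<oplus>\<^bsub>quotient_module M N\<^esub> (N +>\<^bsub>M\<^esub> w) = N +>\<^bsub>M\<^esub> (v \<oplus>\<^bsub>M\<^esub> w)"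
  unfolding quotient_module_def using N.a_rcos_sum[OF assms] by simp

lemma quotient_module_smult:
  assumes r: "r \<in> carrier R" and v: "v \<in> carrier M"
  shows "r \<odot>\<^bsub>quotient_module M N\<^esub> (N +>\<^bsub>M\<^esub> v) = N +>\<^bsub>M\<^esub> (r \<odot>\<^bsub>M\<^esub> v)"
proof -
  have "N +>\<^bsub>M\<^esub> (r \<odot>\<^bsub>M\<^esub> w) = N +>\<^bsub>M\<^esub> (r \<odot>\<^bsub>M\<^esub> v)" if w: "w \<in> N +>\<^bsub>M\<^esub> v" for w
  proof -
    have wM: "w \<in> carrier M" by (rule N.a_elemrcos_carrier[OF v w])
    have "w \<ominus>\<^bsub>M\<^esub> v \<in> N" using N.a_rcos_module[OF v wM] w unfolding a_minus_def by simp
    then have "r \<odot>\<^bsub>M\<^esub> (w \<ominus>\<^bsub>M\<^esub> v) \<in> N" using r by simp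
    moreover have "r \<odot>\<^bsub>M\<^esub> (w \<ominus>\<^bsub>M\<^esub> v) = r \<odot>\<^bsub>M\<^esub> w \<ominus>\<^bsub>M\<^esub> r \<odot>\<^bsub>M\<^esub> v"
      using r v wM by (simp add: a_minus_def smult_r_distr smult_r_minus)
    ultimately show ?thesis using coset_eq_iff r v wM by simp
  qed
  moreover have "N +>\<^bsub>M\<^esub> v \<noteq> {}" using N.a_rcos_self[OF v] by blast
  ultimately have "(\<Union>w\<in>N +>\<^bsub>M\<^esub> v. N +>\<^bsub>M\<^esub> (r \<odot>\<^bsub>M\<^esub> w)) = N +>\<^bsub>M\<^esub> (r \<odot>\<^bsub>M\<^esub> v)"
    by (intro SUP_eq_const)
  then show ?thesis unfolding quotient_module_def by simp
qed

lemma injective_on_quotient_iff: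
  assumes a: "a \<in> carrier R"
  shows "(\<forall>V\<in>carrier (quotient_module M N).
      a \<odot>\<^bsub>quotient_module M N\<^esub> V = \<zero>\<^bsub>quotient_module M N\<^esub> \<longrightarrow> V = \<zero>\<^bsub>quotient_module M N\<^esub>)
    \<longleftrightarrow> (\<forall>v\<in>carrier M. a \<odot>\<^bsub>M\<^esub> v \<in> N \<longrightarrow> v \<in> N)"
  unfolding quotient_module_carrier quotient_module_zero
  by (simp add: quotient_module_smult a coset_eq_submodule_iff)

end

lemma smult_image_submodule:
  assumes a: "a \<in> carrier R"
  shows "LinearCombinations.submodule R ((\<lambda>v. a \<odot>\<^bsub>M\<^esub> v) ` carrier M) M"
proof (rule LinearCombinations.submodule.intro)
  fix v w assume "v \<in> (\<lambda>v. a \<odot>\<^bsub>M\<^esub> v) ` carrier M" "w \<in> (\<lambda>v. a \<odot>\<^bsub>M\<^esub> v) ` carrier M"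
  then show "v \<oplus>\<^bsub>M\<^esub> w \<in> (\<lambda>v. a \<odot>\<^bsub>M\<^esub> v) ` carrier M"
    using a by (auto simp: smult_r_distr[symmetric])
next
  have "\<zero>\<^bsub>M\<^esub> = a \<odot>\<^bsub>M\<^esub> \<zero>\<^bsub>M\<^esub>" using a by simp
  then show "\<zero>\<^bsub>M\<^esub> \<in> (\<lambda>v. a \<odot>\<^bsub>M\<^esub> v) ` carrier M" by (rule image_eqI) simp
next
  fix c v assume c: "c \<in> carrier R" and "v \<in> (\<lambda>v. a \<odot>\<^bsub>M\<^esub> v) ` carrier M"
  then obtain w where w: "w \<in> carrier M" "v = a \<odot>\<^bsub>M\<^esub> w" by blast
  have "c \<odot>\<^bsub>M\<^esub> v = a \<odot>\<^bsub>M\<^esub> (c \<odot>\<^bsub>M\<^esub> w)"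
    using w a c by (simp add: smult_assoc1[symmetric] R.m_comm)
  then show "c \<odot>\<^bsub>M\<^esub> v \<in> (\<lambda>v. a \<odot>\<^bsub>M\<^esub> v) ` carrier M" using w(1) c by blast
qed (use a is_module in auto)

lemma ideal_smult_submodule:
  assumes "J \<subseteq> carrier R"
  shows "LinearCombinations.submodule R (ideal_smult R J M) M"
  unfolding ideal_smult_def by (rule span_is_submodule) (use assms in auto)

lemma smult_in_ideal_smult:
  assumes "J \<subseteq> carrier R" "a \<in> J" "v \<in> carrier M"
  shows "a \<odot>\<^bsub>M\<^esub> v \<in> ideal_smult R J M"
proof -
  have "{a \<odot>\<^bsub>M\<^esub> v |a v. a \<in> J \<and> v \<in> carrier M} \<subseteq> ideal_smult R J M"
    unfolding ideal_smult_def by (rule in_own_span) (use assms(1) in auto)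
  then show ?thesis using assms(2,3) by blast
qed

lemma ideal_smult_PIdl:
  assumes a: "a \<in> carrier R"
  shows "ideal_smult R (PIdl a) M = (\<lambda>v. a \<odot>\<^bsub>M\<^esub> v) ` carrier M"
proof
  have sub: "PIdl a \<subseteq> carrier R" unfolding cgenideal_def using a by auto
  show "(\<lambda>v. a \<odot>\<^bsub>M\<^esub> v) ` carrier M \<subseteq> ideal_smult R (PIdl a) M"
    using smult_in_ideal_smult[OF sub R.cgenideal_self[OF a]] by blast
  show "ideal_smult R (PIdl a) M \<subseteq> (\<lambda>v. a \<odot>\<^bsub>M\<^esub> v) ` carrier M"
    unfolding ideal_smult_def
  proof (rule span_is_subset[OF _ smult_image_submodule[OF a]], rule subsetI)
    fix w assume "w \<in> {b \<odot>\<^bsub>M\<^esub> v |b v. b \<in> PIdl a \<and> v \<in> carrier M}"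
    then obtain r v where w: "r \<in> carrier R" "v \<in> carrier M" "w = (r \<otimes> a) \<odot>\<^bsub>M\<^esub> v"
      unfolding cgenideal_def by blast
    then have "w = a \<odot>\<^bsub>M\<^esub> (r \<odot>\<^bsub>M\<^esub> v)" using a by (simp add: smult_assoc1[symmetric] R.m_comm)
    then show "w \<in> (\<lambda>v. a \<odot>\<^bsub>M\<^esub> v) ` carrier M" using w(1,2) by blast
  qed
qed

lemma ideal_smult_empty: "ideal_smult R (Idl {}) M = {\<zero>\<^bsub>M\<^esub>}"
proof -
  have "Idl {} = Idl {\<zero>}"
    using R.genideal_minimal[OF R.zeroideal, of "{}"] R.genideal_zero
      additive_subgroup.zero_closed[OF ideal.axioms(1)[OF R.genideal_ideal[of "{}"]]] by auto
  also have "\<dots> = PIdl \<zero>" by (simp add: R.cgenideal_eq_genideal)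
  finally show ?thesis using ideal_smult_PIdl[OF R.zero_closed] by auto
qed

lemma regular_sequence_iff:
  assumes xs: "set xs \<subseteq> carrier R"
  shows "regular_sequence R M xs \<longleftrightarrow>
    (\<forall>i<length xs. \<forall>v\<in>carrier M. xs ! i \<odot>\<^bsub>M\<^esub> v \<in> ideal_smult R (Idl (set (take i xs))) M
      \<longrightarrow> v \<in> ideal_smult R (Idl (set (take i xs))) M) \<and>
    ideal_smult R (Idl (set xs)) M \<noteq> carrier M"
proof -
  have inj: "(\<forall>V\<in>carrier (quotient_module M (ideal_smult R (Idl (set (take i xs))) M)).
      xs ! i \<odot>\<^bsub>quotient_module M (ideal_smult R (Idl (set (take i xs))) M)\<^esub> V
        = \<zero>\<^bsub>quotient_module M (ideal_smult R (Idl (set (take i xs))) M)\<^esub>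
      \<longrightarrow> V = \<zero>\<^bsub>quotient_module M (ideal_smult R (Idl (set (take i xs))) M)\<^esub>)
    \<longleftrightarrow> (\<forall>v\<in>carrier M. xs ! i \<odot>\<^bsub>M\<^esub> v \<in> ideal_smult R (Idl (set (take i xs))) M
      \<longrightarrow> v \<in> ideal_smult R (Idl (set (take i xs))) M)" if "i < length xs" for i
  proof (rule injective_on_quotient_iff)
    show "LinearCombinations.submodule R (ideal_smult R (Idl (set (take i xs))) M) M"
      by (intro ideal_smult_submodule R.genideal_subset_carrier subset_trans[OF set_take_subset xs])
    show "xs ! i \<in> carrier R" using xs nth_mem[OF that] by (rule subsetD)
  qed
  show ?thesis unfolding regular_sequence_def Let_def using inj by (simp cong: conj_cong)
qed

lemma regular_sequence_Cons_injective:
  assumes "set (a # xs) \<subseteq> carrier R" "regular_sequence R M (a # xs)"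
    and v: "v \<in> carrier M" "a \<odot>\<^bsub>M\<^esub> v = \<zero>\<^bsub>M\<^esub>"
  shows "v = \<zero>\<^bsub>M\<^esub>"
  using conjunct1[OF assms(2)[unfolded regular_sequence_iff[OF assms(1)]], rule_format, of 0 v] v
  by (simp add: ideal_smult_empty)

lemma regular_sequence_singleton:
  assumes a: "a \<in> carrier R"
    and inj: "\<And>v. v \<in> carrier M \<Longrightarrow> a \<odot>\<^bsub>M\<^esub> v = \<zero>\<^bsub>M\<^esub> \<Longrightarrow> v = \<zero>\<^bsub>M\<^esub>"
    and proper: "w \<in> carrier M" "\<And>v. v \<in> carrier M \<Longrightarrow> a \<odot>\<^bsub>M\<^esub> v \<noteq> w"
  shows "regular_sequence R M [a]"
proof -
  have "w \<notin> (\<lambda>v. a \<odot>\<^bsub>M\<^esub> v) ` carrier M"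
    using proper(2) by (metis imageE)
  then have "ideal_smult R (Idl {a}) M \<noteq> carrier M"
    unfolding R.cgenideal_eq_genideal[OF a, symmetric] ideal_smult_PIdl[OF a]
    using proper(1) by metis
  moreover have "set [a] \<subseteq> carrier R" using a by simp
  ultimately show ?thesis
    using inj by (subst regular_sequence_iff) (simp_all add: ideal_smult_empty)
qed

text \<open>
  If \<open>b\<^sup>k \<in> aR\<close>, then \<open>b\<close> is nilpotent on \<open>M/aM\<close>, and being injective there it forces
  \<open>M = aM\<close>, which a regular sequence excludes.
\<close>

lemma regular_sequence_pow_not_in_PIdl:
  assumes xs: "set (a # b # xs) \<subseteq> carrier R" and reg: "regular_sequence R M (a # b # xs)"
  shows "b [^] (k::nat) \<notin> PIdl a"
proof
  assume k: "b [^] k \<in> PIdl a"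
  have a: "a \<in> carrier R" and b: "b \<in> carrier R" using xs by auto
  let ?aM = "(\<lambda>v. a \<odot>\<^bsub>M\<^esub> v) ` carrier M"
  have eq: "ideal_smult R (Idl {a}) M = ?aM"
    using ideal_smult_PIdl[OF a] R.cgenideal_eq_genideal[OF a] by simp
  note second = conjunct1[OF reg[unfolded regular_sequence_iff[OF xs]], rule_format, of 1]
  have inj: "v \<in> ?aM" if "v \<in> carrier M" "b \<odot>\<^bsub>M\<^esub> v \<in> ?aM" for v
    using second[of v] that unfolding eq[symmetric] by simp
  have pow: "v \<in> ?aM" if "v \<in> carrier M" "b [^] n \<odot>\<^bsub>M\<^esub> v \<in> ?aM" for v and n :: nat
    using that
  proof (induct n arbitrary: v)
    case 0 then show ?case by simp
  next
    case (Suc n)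
    then have "b [^] n \<odot>\<^bsub>M\<^esub> (b \<odot>\<^bsub>M\<^esub> v) \<in> ?aM" using b by (simp add: smult_assoc1)
    then have "b \<odot>\<^bsub>M\<^esub> v \<in> ?aM" using Suc b by simp
    then show ?case using inj Suc by blast
  qed
  obtain r where r: "r \<in> carrier R" "b [^] k = r \<otimes> a"
    using k unfolding cgenideal_def mem_Collect_eq by (elim exE conjE)
  have "v \<in> ?aM" if v: "v \<in> carrier M" for v
  proof (rule pow[OF v, of k])
    have "b [^] k \<odot>\<^bsub>M\<^esub> v = a \<odot>\<^bsub>M\<^esub> (r \<odot>\<^bsub>M\<^esub> v)"
      using r a v by (simp add: smult_assoc1[symmetric] R.m_comm)
    then show "b [^] k \<odot>\<^bsub>M\<^esub> v \<in> ?aM" using r(1) v by simp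
  qed
  moreover have "?aM \<subseteq> ideal_smult R (Idl (set (a # b # xs))) M"
  proof -
    have "a \<in> Idl (set (a # b # xs))" using R.genideal_self[OF xs] by simp
    then show ?thesis using smult_in_ideal_smult[OF R.genideal_subset_carrier[OF xs]] by blast
  qed
  moreover have "ideal_smult R (Idl (set (a # b # xs))) M \<subseteq> carrier M"
    by (rule LinearCombinations.submodule.subset
        [OF ideal_smult_submodule[OF R.genideal_subset_carrier[OF xs]]])
  ultimately have "ideal_smult R (Idl (set (a # b # xs))) M = carrier M" by blast
  then show False using conjunct2[OF reg[unfolded regular_sequence_iff[OF xs]]] by simp
qed

end

section \<open>Ideals as modules\<close>

text \<open>
  The \<open>\<delta>\<close>-invariant quantifies over modules on one fixed carrier type. Relabelling the elements of an
  ideal along an injection \<open>\<iota>\<close> turns the ideal into a module on that type.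
\<close>

definition ideal_copy ::
    "('a, 'b) ring_scheme \<Rightarrow> ('a \<Rightarrow> 'c) \<Rightarrow> 'a set \<Rightarrow> ('a, 'c) module" where
  "ideal_copy R \<iota> I =
     \<lparr>carrier = \<iota> ` I, monoid.mult = (\<lambda>_ _. \<iota> \<zero>\<^bsub>R\<^esub>), one = \<iota> \<zero>\<^bsub>R\<^esub>, zero = \<iota> \<zero>\<^bsub>R\<^esub>,
      add = (\<lambda>u v. \<iota> (the_inv \<iota> u \<oplus>\<^bsub>R\<^esub> the_inv \<iota> v)), smult = (\<lambda>r u. \<iota> (r \<otimes>\<^bsub>R\<^esub> the_inv \<iota> u))\<rparr>"

locale copied_ideal = cring R + ideal I R for R (structure) and I +
  fixes \<iota> :: "'a \<Rightarrow> 'c"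
  assumes inj: "inj \<iota>"
begin

abbreviation "X \<equiv> ideal_copy R \<iota> I"

lemma \<iota>_eq [simp]: "\<iota> a = \<iota> b \<longleftrightarrow> a = b" using inj by (simp add: inj_eq)

lemma copy_simps [simp]:
  "carrier X = \<iota> ` I" "\<zero>\<^bsub>X\<^esub> = \<iota> \<zero>"
  "\<iota> a \<oplus>\<^bsub>X\<^esub> \<iota> b = \<iota> (a \<oplus> b)" "r \<odot>\<^bsub>X\<^esub> \<iota> a = \<iota> (r \<otimes> a)"
  by (simp_all add: ideal_copy_def the_inv_f_f[OF inj])

lemma module_copy: "module R X"
proof (rule module_criteria)
  show "\<forall>v\<in>carrier X. \<exists>w\<in>carrier X. v \<oplus>\<^bsub>X\<^esub> w = \<zero>\<^bsub>X\<^esub>"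
  proof
    fix v assume "v \<in> carrier X"
    then obtain a where a: "v = \<iota> a" "a \<in> I" unfolding copy_simps by (elim imageE)
    have "v \<oplus>\<^bsub>X\<^esub> \<iota> (\<ominus> a) = \<zero>\<^bsub>X\<^esub>" using a Icarr[OF a(2)] by (simp add: r_neg)
    moreover have "\<iota> (\<ominus> a) \<in> carrier X" using a(2) by simp
    ultimately show "\<exists>w\<in>carrier X. v \<oplus>\<^bsub>X\<^esub> w = \<zero>\<^bsub>X\<^esub>" by (rule bexI)
  qed
qed (auto simp: is_cring Icarr I_l_closed a_ac l_distr r_distr m_assoc)

lemma finitely_generated_copy:
  assumes "noetherian_ring R"
  shows "finitely_generated R X"
proof -
  interpret X: module R X by (rule module_copy)
  obtain A where A: "A \<subseteq> carrier R" "finite A" "I = Idl A"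
    using noetherian_ring.finetely_gen[OF assms is_ideal] by blast
  have AI: "A \<subseteq> I" using genideal_self[OF A(1)] A(3) by simp
  then have sub: "\<iota> ` A \<subseteq> carrier X" by auto
  interpret S: LinearCombinations.submodule R "X.span (\<iota> ` A)" X
    by (rule X.span_is_submodule[OF sub])
  let ?J = "{a \<in> I. \<iota> a \<in> X.span (\<iota> ` A)}"
  \<comment> \<open>The elements of the ideal whose copies lie in the span form an ideal containing all generators.\<close>
  have "ideal ?J R"
  proof (rule idealI[OF ring_axioms])
    show "subgroup ?J (add_monoid R)"
    proof
      show "\<one>\<^bsub>add_monoid R\<^esub> \<in> ?J" using S.zero_closed by simp
      fix a assume a: "a \<in> ?J"
      show "inv\<^bsub>add_monoid R\<^esub> a \<in> ?J"
        using a S.smult_closed[of "\<ominus> \<one>" "\<iota> a"] Icarr[of a] by (simp add: a_inv_def[symmetric] l_minus)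
      fix b assume "b \<in> ?J"
      then show "a \<otimes>\<^bsub>add_monoid R\<^esub> b \<in> ?J" using a S.m_closed[of "\<iota> a" "\<iota> b"] by simp
    qed (auto simp: Icarr)
    fix a r assume a: "a \<in> ?J" "r \<in> carrier R"
    then show "r \<otimes> a \<in> ?J" using S.smult_closed[of r "\<iota> a"] I_l_closed by simp
    then show "a \<otimes> r \<in> ?J" using a Icarr m_comm by simp
  qed
  moreover have "A \<subseteq> ?J" using X.in_own_span[OF sub] AI by blast
  ultimately have "I \<subseteq> ?J" unfolding A(3) by (rule genideal_minimal)
  then have "X.span (\<iota> ` A) = carrier X" using S.subset by auto
  then show ?thesis
    unfolding finitely_generated_def using A(2) sub by blast
qed

text \<open>
  Let \<open>a\<close> be a basis element of the free summand \<open>F\<close>. A complement of \<open>F\<close> is annihilated by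
  \<open>a\<close>, and \<open>a\<close> is a nonzerodivisor, so \<open>F\<close> is all of \<open>I\<close>. For \<open>c \<in> I\<close>, the relation
  \<open>a c = c a\<close> compares coordinates at the basis element: \<open>c\<close> is \<open>a\<close> times its own coordinate.
\<close>

lemma free_direct_summand_imp_principal:
  assumes "has_free_direct_summand R X"
  shows "principalideal I R"
proof -
  interpret X: module R X by (rule module_copy)
  obtain F N n where F: "LinearCombinations.submodule R F X"
    and N: "LinearCombinations.submodule R N X"
    and disj: "F \<inter> N = {\<zero>\<^bsub>X\<^esub>}" and sum: "X.submodule_sum F N = carrier X"
    and n: "n \<ge> 1" and iso: "module_iso R (X\<lparr>carrier := F\<rparr>) (free_module R n)"
    using assms unfolding has_free_direct_summand_def by blast
  interpret F: LinearCombinations.submodule R F X by fact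
  interpret N: LinearCombinations.submodule R N X by fact
  obtain f where hom: "f \<in> module_hom R (X\<lparr>carrier := F\<rparr>) (free_module R n)"
    and bij: "bij_betw f F (carrier (free_module R n))"
    using iso unfolding module_iso_def by auto
  have f_in: "f v \<in> {..<n} \<rightarrow>\<^sub>E carrier R" if "v \<in> F" for v
    using that bij_betwE[OF bij] by (simp add: free_module_def func_space_def)
  have f_smult: "f (r \<odot>\<^bsub>X\<^esub> v) 0 = r \<otimes> f v 0" if "r \<in> carrier R" "v \<in> F" for r v
    using module_hom_smult[OF hom, of r v] that n by (simp add: free_module_def func_space_def)
  define e where "e = (\<lambda>j\<in>{..<n}. if j = 0 then \<one> else \<zero>)"
  have "e \<in> carrier (free_module R n)" by (auto simp: e_def free_module_def func_space_def)
  then have "e \<in> f ` F" using bij_betw_imp_surj_on[OF bij] by simp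
  then obtain v where v: "v \<in> F" "f v = e" by (elim imageE) simp
  then obtain a where a: "a \<in> I" "v = \<iota> a" using F.subset by auto
  have aR: "a \<in> carrier R" using a(1) by (rule Icarr)
  have e0: "f (\<iota> a) 0 = \<one>" using v a n by (simp add: e_def)
  have nzd: "r = \<zero>" if r: "r \<in> carrier R" "a \<otimes> r = \<zero>" for r
  proof -
    \<comment> \<open>The first coordinate of the basis element is one, so nothing but zero annihilates it.\<close>
    have va: "\<iota> a \<in> F" using v(1) a(2) by simp
    have "r \<odot>\<^bsub>X\<^esub> \<iota> a = \<zero> \<odot>\<^bsub>X\<^esub> \<iota> a" using r aR by (simp add: m_comm)
    then have "r \<otimes> f (\<iota> a) 0 = \<zero> \<otimes> f (\<iota> a) 0"
      unfolding f_smult[OF r(1) va, symmetric] f_smult[OF Icarr[OF zero_closed] va, symmetric] by simp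
    then show ?thesis using r(1) e0 by simp
  qed
  have N0: "u = \<zero>\<^bsub>X\<^esub>" if u: "u \<in> N" for u
  proof -
    obtain b where b: "b \<in> I" "u = \<iota> b" using u N.subset by auto
    have bR: "b \<in> carrier R" using b(1) by (rule Icarr)
    have "\<iota> (a \<otimes> b) \<in> N" using N.smult_closed[OF aR u] b by simp
    moreover have "\<iota> (a \<otimes> b) \<in> F"
      using F.smult_closed[OF bR v(1)] a m_comm[OF aR bR] by simp
    ultimately have "\<iota> (a \<otimes> b) \<in> {\<zero>\<^bsub>X\<^esub>}" unfolding disj[symmetric] by (rule IntI[rotated])
    then have "a \<otimes> b = \<zero>" by simp
    then show ?thesis using nzd[OF bR] b by simp
  qed
  have "c \<in> PIdl a" if c: "c \<in> I" for c
  proof -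
    have cR: "c \<in> carrier R" using c by (rule Icarr)
    have "\<iota> c \<in> X.submodule_sum F N" using c sum by simp
    then obtain w u where w: "w \<in> F" "u \<in> N" "\<iota> c = w \<oplus>\<^bsub>X\<^esub> u"
      unfolding X.submodule_sum_def by auto
    obtain d where d: "d \<in> I" "w = \<iota> d" using w(1) F.subset by auto
    have "\<iota> c = w" using w N0[OF w(2)] d Icarr[OF d(1)] by simp
    then have cF: "\<iota> c \<in> F" using w(1) by simp
    have "a \<odot>\<^bsub>X\<^esub> \<iota> c = c \<odot>\<^bsub>X\<^esub> \<iota> a" using m_comm[OF aR cR] by simp
    then have "a \<otimes> f (\<iota> c) 0 = c \<otimes> f (\<iota> a) 0"
      using f_smult[OF aR cF] f_smult[OF cR, of "\<iota> a"] v a by simp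
    then have eq: "a \<otimes> f (\<iota> c) 0 = c" using e0 cR by simp
    have coord: "f (\<iota> c) 0 \<in> carrier R" using PiE_mem[OF f_in[OF cF], of 0] n by simp
    have "f (\<iota> c) 0 \<otimes> a \<in> PIdl a" unfolding cgenideal_def using coord by blast
    then show ?thesis using eq m_comm[OF coord aR] by simp
  qed
  then have "I \<subseteq> PIdl a" by (rule subsetI)
  then have "I = PIdl a" using cgenideal_minimal[OF is_ideal a(1)] by (rule subset_antisym)
  then show ?thesis using cgenideal_is_principalideal[OF aR] by simp
qed

end

lemma (in cring) module_ring_as_module: "module R (ring_as_module R)"
proof (rule module_criteria)
  show "\<forall>v\<in>carrier (ring_as_module R). \<exists>w\<in>carrier (ring_as_module R).
      v \<oplus>\<^bsub>ring_as_module R\<^esub> w = \<zero>\<^bsub>ring_as_module R\<^esub>"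
  proof
    fix v assume "v \<in> carrier (ring_as_module R)"
    then show "\<exists>w\<in>carrier (ring_as_module R). v \<oplus>\<^bsub>ring_as_module R\<^esub> w = \<zero>\<^bsub>ring_as_module R\<^esub>"
      by (intro bexI[of _ "\<ominus> v"]) (simp_all add: ring_as_module_def r_neg)
  qed
qed (auto simp: ring_as_module_def is_cring a_ac l_distr r_distr m_assoc)

text \<open>
  The map sends \<open>j + a x\<close> with \<open>j \<in> N\<close> to \<open>a + K\<close>. Two representations \<open>j + a x = i + b x\<close> give
  \<open>x (b - a) \<in> N\<close> and therefore \<open>b - a \<in> K\<close>, so the map is well defined.
\<close>

lemma (in cring) exists_surjection_onto_quotient:
  assumes "copied_ideal R (N <+>\<^bsub>R\<^esub> PIdl x) \<iota>"
    and N: "ideal N R" and K: "ideal K R" and x: "x \<in> carrier R"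
    and cancel: "\<And>a. a \<in> carrier R \<Longrightarrow> x \<otimes> a \<in> N \<Longrightarrow> a \<in> K"
  obtains g where
    "g \<in> module_hom R (ideal_copy R \<iota> (N <+>\<^bsub>R\<^esub> PIdl x)) (quotient_module (ring_as_module R) K)"
    "g ` carrier (ideal_copy R \<iota> (N <+>\<^bsub>R\<^esub> PIdl x)) = carrier (quotient_module (ring_as_module R) K)"
proof -
  interpret C: copied_ideal R "N <+>\<^bsub>R\<^esub> PIdl x" \<iota> by fact
  interpret N: ideal N R by fact
  interpret K: ideal K R by fact
  let ?Q = "quotient_module (ring_as_module R) K"
  interpret RM: module R "ring_as_module R" by (rule module_ring_as_module)
  have sub: "LinearCombinations.submodule R K (ring_as_module R)"
    by (rule LinearCombinations.submodule.intro[OF module_ring_as_module])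
      (auto simp: ring_as_module_def K.I_l_closed K.Icarr)
  have coset: "K +>\<^bsub>ring_as_module R\<^esub> a = K +> a" for a
    unfolding a_r_coset_def' by (simp add: ring_as_module_def)
  have carrQ: "carrier ?Q = (\<lambda>a. K +> a) ` carrier R"
    using RM.quotient_module_carrier[OF sub] coset by (simp add: ring_as_module_def)
  have addQ: "(K +> a) \<oplus>\<^bsub>?Q\<^esub> (K +> b) = K +> (a \<oplus> b)" if "a \<in> carrier R" "b \<in> carrier R" for a b
    using RM.quotient_module_add[OF sub, of a b] that coset by (simp add: ring_as_module_def)
  have smultQ: "r \<odot>\<^bsub>?Q\<^esub> (K +> a) = K +> (r \<otimes> a)" if "r \<in> carrier R" "a \<in> carrier R" for a r
    using RM.quotient_module_smult[OF sub, of r a] that coset by (simp add: ring_as_module_def)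
  define h where "h u = (SOME A. \<exists>j\<in>N. \<exists>a\<in>carrier R. u = j \<oplus> a \<otimes> x \<and> A = K +> a)" for u
  have h: "h (j \<oplus> a \<otimes> x) = K +> a" if j: "j \<in> N" and a: "a \<in> carrier R" for j a
    unfolding h_def
  proof (rule some_equality)
    show "\<exists>i\<in>N. \<exists>b\<in>carrier R. j \<oplus> a \<otimes> x = i \<oplus> b \<otimes> x \<and> K +> a = K +> b" using j a by blast
    fix A assume "\<exists>i\<in>N. \<exists>b\<in>carrier R. j \<oplus> a \<otimes> x = i \<oplus> b \<otimes> x \<and> A = K +> b"
    then obtain i b where b: "i \<in> N" "b \<in> carrier R" "j \<oplus> a \<otimes> x = i \<oplus> b \<otimes> x" "A = K +> b"
      by (elim bexE conjE)
    have c: "i \<in> carrier R" "j \<in> carrier R" using b(1) j N.Icarr by auto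
    have "x \<otimes> (b \<ominus> a) = j \<ominus> i"
    proof -
      have "x \<otimes> (b \<ominus> a) = \<ominus> i \<oplus> (i \<oplus> b \<otimes> x) \<ominus> a \<otimes> x" using c a b(2) x by algebra
      also have "\<dots> = \<ominus> i \<oplus> (j \<oplus> a \<otimes> x) \<ominus> a \<otimes> x" using b(3) by simp
      also have "\<dots> = j \<ominus> i" using c a x by algebra
      finally show ?thesis .
    qed
    also have "\<dots> \<in> N" unfolding a_minus_def using b(1) j by simp
    finally have "b \<ominus> a \<in> K" using cancel a b(2) by simp
    then show "A = K +> a" using quotient_eq_iff_same_a_r_cos[OF K] a b by simp
  qed
  let ?X = "ideal_copy R \<iota> (N <+>\<^bsub>R\<^esub> PIdl x)"
  let ?g = "\<lambda>v. h (the_inv \<iota> v)"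
  have g: "?g (\<iota> u) = h u" for u by (simp add: the_inv_f_f[OF C.inj])
  have repr: "\<exists>j\<in>N. \<exists>a\<in>carrier R. u = j \<oplus> a \<otimes> x" if "u \<in> N <+>\<^bsub>R\<^esub> PIdl x" for u
    using that unfolding mem_add_PIdl .
  have elem: "\<exists>j\<in>N. \<exists>a\<in>carrier R. v = \<iota> (j \<oplus> a \<otimes> x)" if v: "v \<in> carrier ?X" for v
  proof -
    obtain u where u: "v = \<iota> u" "u \<in> N <+>\<^bsub>R\<^esub> PIdl x"
      using v unfolding C.copy_simps by (elim imageE)
    then show ?thesis using repr[OF u(2)] by simp
  qed
  have "?g \<in> module_hom R ?X ?Q"
    unfolding module_hom_def
  proof (intro CollectI conjI allI impI)
    show "?g \<in> carrier ?X \<rightarrow> carrier ?Q"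
    proof
      fix v assume "v \<in> carrier ?X"
      then obtain j a where "v = \<iota> (j \<oplus> a \<otimes> x)" "j \<in> N" "a \<in> carrier R"
        using elem[of v] by metis
      then show "?g v \<in> carrier ?Q" unfolding carrQ by (simp only: g h imageI)
    qed
  next
    fix v w assume vw: "v \<in> carrier ?X \<and> w \<in> carrier ?X"
    obtain j a i b where v: "v = \<iota> (j \<oplus> a \<otimes> x)" "j \<in> N" "a \<in> carrier R"
      and w: "w = \<iota> (i \<oplus> b \<otimes> x)" "i \<in> N" "b \<in> carrier R"
      using elem[of v] elem[of w] vw by (elim conjE) metis
    have "(j \<oplus> a \<otimes> x) \<oplus> (i \<oplus> b \<otimes> x) = (j \<oplus> i) \<oplus> (a \<oplus> b) \<otimes> x"
      using v(2,3) w(2,3) x N.Icarr by algebra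
    then have "?g (v \<oplus>\<^bsub>?X\<^esub> w) = h ((j \<oplus> i) \<oplus> (a \<oplus> b) \<otimes> x)"
      unfolding v(1) w(1) C.copy_simps g by simp
    also have "\<dots> = K +> (a \<oplus> b)" using v w by (simp add: h)
    also have "\<dots> = ?g v \<oplus>\<^bsub>?Q\<^esub> ?g w"
      unfolding v(1) w(1) g using v w by (simp add: h addQ)
    finally show "?g (v \<oplus>\<^bsub>?X\<^esub> w) = ?g v \<oplus>\<^bsub>?Q\<^esub> ?g w" .
  next
    fix r v assume rv: "r \<in> carrier R \<and> v \<in> carrier ?X"
    obtain j a where v: "v = \<iota> (j \<oplus> a \<otimes> x)" "j \<in> N" "a \<in> carrier R"
      using elem[of v] rv by (elim conjE) metis
    have "r \<otimes> (j \<oplus> a \<otimes> x) = r \<otimes> j \<oplus> (r \<otimes> a) \<otimes> x"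
      using v(2,3) rv x N.Icarr by (simp add: r_distr m_assoc)
    then have "?g (r \<odot>\<^bsub>?X\<^esub> v) = h (r \<otimes> j \<oplus> (r \<otimes> a) \<otimes> x)"
      unfolding v(1) C.copy_simps g by simp
    also have "\<dots> = K +> (r \<otimes> a)" using v rv by (simp add: h N.I_l_closed)
    also have "\<dots> = r \<odot>\<^bsub>?Q\<^esub> ?g v" unfolding v(1) g using v rv by (simp add: h smultQ)
    finally show "?g (r \<odot>\<^bsub>?X\<^esub> v) = r \<odot>\<^bsub>?Q\<^esub> ?g v" .
  qed
  moreover have "?g ` carrier ?X = carrier ?Q"
  proof
    show "?g ` carrier ?X \<subseteq> carrier ?Q"
      using module_hom_closed[OF \<open>?g \<in> module_hom R ?X ?Q\<close>] by blast
    show "carrier ?Q \<subseteq> ?g ` carrier ?X"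
    proof
      fix A assume "A \<in> carrier ?Q"
      then obtain a where a: "a \<in> carrier R" "A = K +> a" unfolding carrQ by blast
      have "A = ?g (\<iota> (\<zero> \<oplus> a \<otimes> x))" unfolding g using a by (simp add: h del: l_zero)
      moreover have "\<zero> \<oplus> a \<otimes> x \<in> N <+>\<^bsub>R\<^esub> PIdl x"
        unfolding mem_add_PIdl using a N.zero_closed by blast
      ultimately show "A \<in> ?g ` carrier ?X" unfolding C.copy_simps by blast
    qed
  qed
  ultimately show thesis by (rule that)
qed

section \<open>Ideals as maximal Cohen--Macaulay modules\<close>

context noetherian_local_ring
begin

text \<open>
  The one-element sequence \<open>x\<close> is regular on \<open>I\<close>: it is proper because \<open>x = x b\<close> with \<open>b \<in> I\<close>
  would give \<open>b = 1\<close>. In a longer regular sequence \<open>a, b, \<dots>\<close> the element \<open>a\<close>, being injective on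
  \<open>xR \<subseteq> I\<close>, would be a nonzerodivisor of \<open>R\<close>, and dimension one would put a power of \<open>b\<close>
  into \<open>aR\<close>.
\<close>

lemma maximal_cohen_macaulay_ideal_copy:
  assumes dim: "krull_dim R = 1" and C: "copied_ideal R I \<iota>"
    and x: "nonzerodivisor R x" "x \<in> I" and I: "I \<subseteq> \<mm>"
  shows "maximal_cohen_macaulay R \<mm> (ideal_copy R \<iota> I)"
proof -
  interpret C: copied_ideal R I \<iota> by fact
  interpret X: module R "ideal_copy R \<iota> I" by (rule C.module_copy)
  have xR: "x \<in> carrier R" using x(2) by (rule C.Icarr)
  have x_cancel: "b = \<zero>" if "b \<in> carrier R" "x \<otimes> b = \<zero>" for b
    using x(1) that unfolding nonzerodivisor_def by simp
  have "regular_sequence R (ideal_copy R \<iota> I) [x]"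
  proof (rule X.regular_sequence_singleton[OF xR])
    fix v assume v: "v \<in> carrier C.X" "x \<odot>\<^bsub>C.X\<^esub> v = \<zero>\<^bsub>C.X\<^esub>"
    obtain b where b: "v = \<iota> b" "b \<in> I" using v(1) unfolding C.copy_simps by (elim imageE)
    have "x \<otimes> b = \<zero>" using v(2) b by simp
    then show "v = \<zero>\<^bsub>C.X\<^esub>" using x_cancel[OF C.Icarr[OF b(2)]] b(1) by simp
  next
    show "\<iota> x \<in> carrier C.X" using x(2) by simp
    fix v assume "v \<in> carrier C.X"
    then obtain b where b: "v = \<iota> b" "b \<in> I" unfolding C.copy_simps by (elim imageE)
    have bR: "b \<in> carrier R" using b(2) by (rule C.Icarr)
    show "x \<odot>\<^bsub>C.X\<^esub> v \<noteq> \<iota> x"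
    proof
      assume "x \<odot>\<^bsub>C.X\<^esub> v = \<iota> x"
      then have "x \<otimes> b = x" using b(1) by simp
      then have "x \<otimes> (b \<ominus> \<one>) = \<zero>"
        using xR bR by (simp add: a_minus_def r_distr r_minus r_neg)
      then have "b \<ominus> \<one> = \<zero>" using bR by (intro x_cancel[of "b \<ominus> \<one>"]) simp_all
      then have "b = \<one>" using bR by simp
      then show False using b(2) I one_not_in_mm by (simp add: subset_iff)
    qed
  qed
  moreover have "set [x] \<subseteq> \<mm>" using x(2) I by auto
  ultimately have ge: "enat (length [x]) \<in>
      {enat (length xs) |xs. set xs \<subseteq> \<mm> \<and> regular_sequence R (ideal_copy R \<iota> I) xs}"
    by blast
  have le: "length xs \<le> 1" if xs: "set xs \<subseteq> \<mm>" "regular_sequence R (ideal_copy R \<iota> I) xs" for xs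
  proof (rule ccontr)
    assume "\<not> length xs \<le> 1"
    then obtain a b ys where eq: "xs = a # b # ys"
      by (cases xs; cases "tl xs") auto
    have carr: "set (a # b # ys) \<subseteq> carrier R"
      using xs(1) ideal.Icarr[OF ideal_mm] unfolding eq by (meson subsetD subsetI)
    have reg: "regular_sequence R C.X (a # b # ys)" using xs(2) unfolding eq .
    have aR: "a \<in> carrier R" using carr by simp
    have "nonzerodivisor R a"
      unfolding nonzerodivisor_def
    proof (intro conjI ballI impI aR)
      fix y assume y: "y \<in> carrier R" "a \<otimes> y = \<zero>"
      have xy: "x \<otimes> y \<in> I" using x(2) y(1) by (rule C.I_r_closed)
      have "a \<otimes> (x \<otimes> y) = x \<otimes> (a \<otimes> y)" using aR xR y(1) by (simp add: m_ac)
      then have "a \<odot>\<^bsub>C.X\<^esub> \<iota> (x \<otimes> y) = \<zero>\<^bsub>C.X\<^esub>" using y(2) xR by simp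
      then have "\<iota> (x \<otimes> y) = \<zero>\<^bsub>C.X\<^esub>"
        using X.regular_sequence_Cons_injective[OF carr reg, of "\<iota> (x \<otimes> y)"] xy by simp
      then show "y = \<zero>" using x_cancel[OF y(1)] by simp
    qed
    moreover have "a \<in> \<mm>" "b \<in> \<mm>" using xs(1) unfolding eq by auto
    ultimately obtain k :: nat where "b [^] k \<in> PIdl a"
      by (rule power_in_PIdl_nonzerodivisor[OF dim])
    then show False using X.regular_sequence_pow_not_in_PIdl[OF carr reg] by simp
  qed
  have "depth R \<mm> (ideal_copy R \<iota> I) = enat 1"
    unfolding depth_def
  proof (rule antisym)
    show "Sup {enat (length xs) |xs. set xs \<subseteq> \<mm> \<and> regular_sequence R C.X xs} \<le> enat 1"
      by (rule Sup_least) (use le in auto)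
    show "enat 1 \<le> Sup {enat (length xs) |xs. set xs \<subseteq> \<mm> \<and> regular_sequence R C.X xs}"
      using Sup_upper[OF ge] by simp
  qed
  then show ?thesis
    unfolding maximal_cohen_macaulay_def dim
    using X.is_module C.finitely_generated_copy[OF noetherian_ring_axioms] by (simp add: one_enat_def)
qed

end

section \<open>The index and the generalized Loewy length\<close>

text \<open>
  The free module \<open>R^0\<close> has a single element, so a surjection from \<open>X\<close> alone shows that the
  \<open>\<delta>\<close>-invariant is \<open>0\<close>.
\<close>

lemma delta_eq_zero:
  fixes X :: "('a, (nat \<Rightarrow> 'a) set) module"
  assumes "cring R" and "maximal_cohen_macaulay R \<mm> X" "\<not> has_free_direct_summand R X"
    and g: "g \<in> module_hom R X M" "g ` carrier X = carrier M"
  shows "delta R \<mm> M = 0"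
proof -
  interpret cring R by fact
  let ?S = "direct_sum X (free_module R 0)"
  have carr: "carrier ?S = carrier X \<times> {\<lambda>_. undefined}"
    by (simp add: direct_sum_def free_module_def func_space_def)
  have "g \<circ> fst \<in> module_hom R ?S M"
    using g(1) unfolding module_hom_def carr by (auto simp: direct_sum_def)
  moreover have "(g \<circ> fst) ` carrier ?S = carrier M"
    unfolding carr image_comp[symmetric] using g(2) by simp
  ultimately have "\<exists>f\<in>module_hom R ?S M. f ` carrier ?S = carrier M" by blast
  then have "delta R \<mm> M \<le> enat 0"
    unfolding delta_def using assms(2,3) by (intro Inf_lower) blast
  then show ?thesis by (simp add: zero_enat_def[symmetric])
qed

lemma ring_index_attained:
  assumes "ring_index R \<mm> = enat s"
  shows "s \<ge> 1" "delta R \<mm> (quotient_module (ring_as_module R) (ideal_power R \<mm> s)) = 1"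
proof -
  let ?S = "{enat n |n. n \<ge> 1 \<and>
    delta R \<mm> (quotient_module (ring_as_module R) (ideal_power R \<mm> n)) = 1}"
  have eq: "Inf ?S = enat s" using assms unfolding ring_index_def .
  have "?S \<noteq> {}"
  proof
    assume "?S = {}"
    then show False using eq by (simp only: Inf_enat_def) simp
  qed
  then obtain k where "k \<in> ?S" by (meson ex_in_conv)
  then have "Inf ?S \<in> ?S" by (rule wellorder_InfI)
  then have "enat s \<in> ?S" unfolding eq .
  then show "s \<ge> 1" "delta R \<mm> (quotient_module (ring_as_module R) (ideal_power R \<mm> s)) = 1" by auto
qed

theorem theorem2p3:
  fixes R :: "('a, 'b) ring_scheme" and \<mm> :: "'a set" and x :: 'a and s t :: nat
  assumes "cohen_macaulay_local_ring R \<mm>"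
    and "krull_dim R = 1"
    and "ring_index R \<mm> = enat s"
    and "t \<ge> 1"
    and "x \<in> ideal_power R \<mm> t - ideal_power R \<mm> (t + 1)"
    and "nonzerodivisor R x"
    and "\<forall>i. 1 \<le> i \<and> i \<le> s \<longrightarrow>
           inj_on (induced_mult R x (ideal_power R \<mm> (i + t)))
             (ideal_quotient R (ideal_power R \<mm> (i - 1)) (ideal_power R \<mm> i))"
  shows "generalized_loewy_length R \<mm> \<le> ring_index R \<mm> + enat t - 1 \<and>
    (\<not> principalideal (ideal_power R \<mm> (s + t - 1)) R \<longrightarrow>
       ideal_power R \<mm> (s + t - 1) \<subseteq> PIdl\<^bsub>R\<^esub> x)"
proof -
  interpret cohen_macaulay_local_ring R \<mm> by fact
  define n where "n = s + t - 1"
  have s: "s \<ge> 1" and delta: "delta R \<mm> (quotient_module (ring_as_module R) (ideal_power R \<mm> s)) = 1"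
    using ring_index_attained[OF assms(3)] by auto
  have n: "n \<ge> 1" "Suc n = s + t" using s assms(4) unfolding n_def by auto
  have xt: "x \<in> ideal_power R \<mm> t" using assms(5) by simp
  have x: "x \<in> carrier R" "x \<in> \<mm>"
    using xt ideal.Icarr[OF ideal_power_ideal] ideal_power_subset_mm[OF assms(4)] by auto
  have cancel: "a \<in> ideal_power R \<mm> s"
    if "a \<in> carrier R" "x \<otimes>\<^bsub>R\<^esub> a \<in> ideal_power R \<mm> (Suc n)" for a
    using injective_induced_mult_cancel[OF xt assms(7) that(1)] that(2) n(2) by simp
  obtain N where N: "ideal N R" "N \<subseteq> ideal_power R \<mm> n"
    and cover: "ideal_power R \<mm> n \<subseteq> N <+>\<^bsub>R\<^esub> PIdl\<^bsub>R\<^esub> x"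
    and cancelN: "\<forall>a\<in>carrier R. x \<otimes>\<^bsub>R\<^esub> a \<in> N \<longrightarrow> a \<in> ideal_power R \<mm> s"
    by (rule exists_complement[OF x(1) cancel])
  let ?I = "N <+>\<^bsub>R\<^esub> PIdl\<^bsub>R\<^esub> x"
  \<comment> \<open>This injection lands in the carrier type over which the \<open>\<delta>\<close>-invariant ranges.\<close>
  define \<iota> :: "'a \<Rightarrow> (nat \<Rightarrow> 'a) set" where "\<iota> a = {\<lambda>_. a}" for a
  have "inj \<iota>" unfolding \<iota>_def by (rule injI) (simp add: fun_eq_iff)
  then have C: "copied_ideal R ?I \<iota>"
    by (intro copied_ideal.intro copied_ideal_axioms.intro is_cring add_PIdl(1)[OF N(1) x(1)])
  have Im: "?I \<subseteq> \<mm>"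
    using add_PIdl_subset[OF ideal_mm _ x(2)] N(2) ideal_power_subset_mm[OF n(1)]
    by (meson subset_trans)
  have princ: "principalideal ?I R"
  proof (rule ccontr)
    assume not_princ: "\<not> principalideal ?I R"
    obtain g where g: "g \<in> module_hom R (ideal_copy R \<iota> ?I)
          (quotient_module (ring_as_module R) (ideal_power R \<mm> s))"
      "g ` carrier (ideal_copy R \<iota> ?I)
          = carrier (quotient_module (ring_as_module R) (ideal_power R \<mm> s))"
      by (rule exists_surjection_onto_quotient[OF C N(1) ideal_power_ideal x(1) cancelN[rule_format]])
    have "delta R \<mm> (quotient_module (ring_as_module R) (ideal_power R \<mm> s)) = 0"
    proof (rule delta_eq_zero[OF is_cring _ _ g])
      show "maximal_cohen_macaulay R \<mm> (ideal_copy R \<iota> ?I)"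
        by (rule maximal_cohen_macaulay_ideal_copy
            [OF assms(2) C assms(6) add_PIdl(3)[OF N(1) x(1)] Im])
      show "\<not> has_free_direct_summand R (ideal_copy R \<iota> ?I)"
        using copied_ideal.free_direct_summand_imp_principal[OF C] not_princ by blast
    qed
    then show False using delta by simp
  qed
  have bound: "generalized_loewy_length R \<mm> \<le> enat n"
    if z: "nonzerodivisor R z" "z \<in> \<mm>" "ideal_power R \<mm> n \<subseteq> PIdl\<^bsub>R\<^esub> z" for z
  proof -
    have zR: "z \<in> carrier R" using z(1) unfolding nonzerodivisor_def by simp
    have "ideal_power R \<mm> n \<subseteq> Idl\<^bsub>R\<^esub> (set [z])" using z(3) cgenideal_eq_genideal[OF zR] by simp
    with nonzerodivisor_system_of_parameters[OF assms(2) z(1,2)]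
    show ?thesis unfolding generalized_loewy_length_def using n(1) by (intro Inf_lower) blast
  qed
  have "generalized_loewy_length R \<mm> \<le> enat n \<and>
    (\<not> principalideal (ideal_power R \<mm> n) R \<longrightarrow> ideal_power R \<mm> n \<subseteq> PIdl\<^bsub>R\<^esub> x)"
  proof (rule principal_sum_cases[OF x(1) N(1) ideal_power_ideal N(2) cover princ])
    assume "ideal_power R \<mm> n \<subseteq> PIdl\<^bsub>R\<^esub> x"
    then show ?thesis using bound[OF assms(6) x(2)] by simp
  next
    fix y assume y: "y \<in> carrier R" "ideal_power R \<mm> n = PIdl\<^bsub>R\<^esub> y" "x \<in> PIdl\<^bsub>R\<^esub> y"
    obtain r where r: "x = r \<otimes>\<^bsub>R\<^esub> y" "r \<in> carrier R"
      using y(3) unfolding cgenideal_def mem_Collect_eq by (elim exE conjE)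
    \<comment> \<open>The multiple \<open>x\<close> of \<open>y\<close> is a nonzerodivisor, hence so is \<open>y\<close>.\<close>
    have "nonzerodivisor R y"
      unfolding nonzerodivisor_def
    proof (intro conjI ballI impI y(1))
      fix z assume z: "z \<in> carrier R" "y \<otimes>\<^bsub>R\<^esub> z = \<zero>\<^bsub>R\<^esub>"
      have "x \<otimes>\<^bsub>R\<^esub> z = r \<otimes>\<^bsub>R\<^esub> (y \<otimes>\<^bsub>R\<^esub> z)" using r y(1) z(1) by (simp add: m_assoc)
      then have "x \<otimes>\<^bsub>R\<^esub> z = \<zero>\<^bsub>R\<^esub>" using z(2) r(2) by simp
      then show "z = \<zero>\<^bsub>R\<^esub>" using assms(6) z(1) unfolding nonzerodivisor_def by simp
    qed
    moreover have "y \<in> \<mm>"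
      using ideal_power_subset_mm[OF n(1)] cgenideal_self[OF y(1)] unfolding y(2) by (rule subsetD)
    ultimately show ?thesis
      using bound[of y] cgenideal_is_principalideal[OF y(1)] y(2) by simp
  qed
  moreover have "ring_index R \<mm> + enat t - 1 = enat n"
    unfolding assms(3) n_def by (simp add: one_enat_def)
  ultimately show ?thesis unfolding n_def by simp
qed

end
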